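(* Let $M$ be a paracompact smooth manifold of dimension $n$, equipped with an atlas $(\phi_i)_{i\in I}$ of charts $\phi_i:B^n\to M$, where $B^n$ is the open unit ball centered at $0$ in $\mathbb{R}^n$, such that each $\phi_i(B^n)$ is a relatively compact open set. Let $(g_i)_{i\in I}$ be a smooth partition of unity subordinated to the covering $(\phi_i(B^n))_{i\in I}$: each $g_i\geqslant 0$ has support inside $\phi_i(B^n)$ and $\sum_i g_i=1$, the sum being locally finite. For positive real numbers $(a_i)_{i\in I}$ and $t>0$ define, for a function $f:M\to\mathbb{R}$, $$G_t(f):=\sum_i\big[R_{ta_i}\big((g_if)\circ\phi_i\big)\big]\circ\phi_i^{-1},$$ where $(g_if)\circ\phi_i$ is regarded as a function on $\mathbb{R}^n$ extended by zero outside $B^n$, each term is a function on $\phi_i(B^n)$ extended by zero to $M$, and for a bounded function $w:\mathbb{R}^n\to\mathbb{R}$ and $s>0$, $R_s w:=\check T_s\circ T_{2s}\circ\check T_s w$ with $$T_sw(x):=\inf_{y\in \mathbb{R}^n}\Big(w(y)+\tfrac{1}{s}\|y-x\|^2\Big),\qquad \check T_sw(x):=\sup_{y\in \mathbb{R}^n}\Big(w(y)-\tfrac{1}{s}\|y-x\|^2\Big).$$ Let $u\geqslant v$ be two continuous functions on $M$ such that $u$ and $-v$ are locally semi-concave. Then the positive numbers $a_i$ can be chosen such that, for each $t\in(0,1]$ and each function $f:M\to\mathbb{R}$ satisfying $u\geqslant f\geqslant v$: \begin{itemize} \item the sum defining $G_t(f)$ is locally finite, so that $G_t(f)$ is well defined;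 \item $G_t(f)$ is locally $C^{1,1}$; \item if $f$ is continuous, then $G_t(f)$ converges locally uniformly to $f$ as $t\to0$; \item $u\geqslant G_t(f)\geqslant v$. \end{itemize}
   Context: A function $u:M\to\mathbb{R}$ is called locally semi-concave (with respect to the fixed atlas) if for each $i\in I$ there is a constant $b_i>0$ such that $u\circ\phi_i-\|\cdot\|^2/b_i$ is concave on $B^n$. A function is $C^{1,1}$ if it is differentiable with Lipschitz gradient; locally $C^{1,1}$ means $C^{1,1}$ in charts on a neighborhood of each point. *)

theory Defs
  imports "HOL-Analysis.Analysis"
begin

(* C^k on an open set S (k-times continuously Frechet differentiable), via directional derivatives
   x \<mapsto> Df(x) v, which stay in the same function type. *)
fun Ck_on :: "nat \<Rightarrow> 'a::real_normed_vector set \<Rightarrow> ('a \<Rightarrow> 'b::real_normed_vector) \<Rightarrow> bool" where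
  "Ck_on 0 S f = continuous_on S f"
| "Ck_on (Suc k) S f =
     (f differentiable_on S \<and> continuous_on S f \<and>
      (\<forall>v. Ck_on k S (\<lambda>x. frechet_derivative f (at x) v)))"

definition smooth_on :: "'a::real_normed_vector set \<Rightarrow> ('a \<Rightarrow> 'b::real_normed_vector) \<Rightarrow> bool" where
  "smooth_on S f \<longleftrightarrow> (\<forall>k. Ck_on k S f)"

abbreviation Bn :: "(real^'n) set" where "Bn \<equiv> ball 0 1"

definition paracompact_space :: "'m::topological_space itself \<Rightarrow> bool" where
  "paracompact_space _ \<longleftrightarrow>
     (\<forall>\<U>::'m set set. (\<forall>U\<in>\<U>. open U) \<and> \<Union>\<U> = UNIV \<longrightarrow>
        (\<exists>\<V>. (\<forall>V\<in>\<V>. open V \<and> (\<exists>U\<in>\<U>. V \<subseteq> U)) \<and> \<Union>\<V> = UNIV \<and>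
             (\<forall>x. \<exists>N. open N \<and> x \<in> N \<and> finite {V\<in>\<V>. V \<inter> N \<noteq> {}})))"

definition smooth_atlas :: "('i \<Rightarrow> real^'n \<Rightarrow> 'm::topological_space) \<Rightarrow> bool" where
  "smooth_atlas \<phi> \<longleftrightarrow>
     (\<forall>i. open (\<phi> i ` Bn) \<and> homeomorphism Bn (\<phi> i ` Bn) (\<phi> i) (inv_into Bn (\<phi> i))
          \<and> compact (closure (\<phi> i ` Bn))) \<and>
     (\<Union>i. \<phi> i ` Bn) = UNIV \<and>
     (\<forall>i j. smooth_on {y\<in>Bn. \<phi> i y \<in> \<phi> j ` Bn} (inv_into Bn (\<phi> j) \<circ> \<phi> i))"

definition smooth_fun :: "('i \<Rightarrow> real^'n \<Rightarrow> 'm::topological_space) \<Rightarrow> ('m \<Rightarrow> real) \<Rightarrow> bool" where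
  "smooth_fun \<phi> h \<longleftrightarrow> (\<forall>j. smooth_on Bn (h \<circ> \<phi> j))"

definition smooth_partition_of_unity ::
  "('i \<Rightarrow> real^'n \<Rightarrow> 'm::topological_space) \<Rightarrow> ('i \<Rightarrow> 'm \<Rightarrow> real) \<Rightarrow> bool" where
  "smooth_partition_of_unity \<phi> g \<longleftrightarrow>
     (\<forall>i. smooth_fun \<phi> (g i) \<and> (\<forall>x. g i x \<ge> 0) \<and>
          closure {x. g i x \<noteq> 0} \<subseteq> \<phi> i ` Bn) \<and>
     (\<forall>x. \<exists>N. open N \<and> x \<in> N \<and> finite {i. closure {y. g i y \<noteq> 0} \<inter> N \<noteq> {}}) \<and>
     (\<forall>x. (\<Sum>i\<in>{i. g i x \<noteq> 0}. g i x) = 1)"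

definition loc_semiconcave :: "('i \<Rightarrow> real^'n \<Rightarrow> 'm) \<Rightarrow> ('m \<Rightarrow> real) \<Rightarrow> bool" where
  "loc_semiconcave \<phi> u \<longleftrightarrow>
     (\<forall>i. \<exists>b>0. concave_on Bn (\<lambda>y. u (\<phi> i y) - (norm y)^2 / b))"

definition T_op :: "real \<Rightarrow> (real^'n \<Rightarrow> real) \<Rightarrow> real^'n \<Rightarrow> real" where
  "T_op s w x = (INF y. w y + (norm (y - x))^2 / s)"

definition Tc_op :: "real \<Rightarrow> (real^'n \<Rightarrow> real) \<Rightarrow> real^'n \<Rightarrow> real" where
  "Tc_op s w x = (SUP y. w y - (norm (y - x))^2 / s)"

definition R_op :: "real \<Rightarrow> (real^'n \<Rightarrow> real) \<Rightarrow> real^'n \<Rightarrow> real" where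
  "R_op s w = Tc_op s (T_op (2 * s) (Tc_op s w))"

definition G_term ::
  "('i \<Rightarrow> real^'n \<Rightarrow> 'm) \<Rightarrow> ('i \<Rightarrow> 'm \<Rightarrow> real) \<Rightarrow> ('i \<Rightarrow> real) \<Rightarrow> real \<Rightarrow> ('m \<Rightarrow> real) \<Rightarrow> 'i \<Rightarrow> 'm \<Rightarrow> real" where
  "G_term \<phi> g a t f i x =
     (if x \<in> \<phi> i ` Bn then
        R_op (t * a i) (\<lambda>y. if y \<in> Bn then g i (\<phi> i y) * f (\<phi> i y) else 0) (inv_into Bn (\<phi> i) x)
      else 0)"

definition G_op ::
  "('i \<Rightarrow> real^'n \<Rightarrow> 'm) \<Rightarrow> ('i \<Rightarrow> 'm \<Rightarrow> real) \<Rightarrow> ('i \<Rightarrow> real) \<Rightarrow> real \<Rightarrow> ('m \<Rightarrow> real) \<Rightarrow> 'm \<Rightarrow> real" where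
  "G_op \<phi> g a t f x = (\<Sum>i\<in>{i. G_term \<phi> g a t f i x \<noteq> 0}. G_term \<phi> g a t f i x)"

definition loc_C11 :: "('i \<Rightarrow> real^'n \<Rightarrow> 'm) \<Rightarrow> ('m \<Rightarrow> real) \<Rightarrow> bool" where
  "loc_C11 \<phi> h \<longleftrightarrow>
     (\<forall>i. \<forall>y\<in>Bn. \<exists>V. open V \<and> y \<in> V \<and> V \<subseteq> Bn \<and>
        (\<exists>grad L. (\<forall>z\<in>V. GDERIV (h \<circ> \<phi> i) z :> grad z) \<and> L-lipschitz_on V grad))"

end

theory Submission
  imports Defs
begin

text \<open>
  Write \<open>T\<^sub>s\<^sup>*\<close> for the sup-convolution. Since \<open>T\<^bsub>2s\<^esub> = T\<^sub>s \<circ> T\<^sub>s\<close>, the operator \<open>R\<^sub>s\<close> factors as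
  \<open>(T\<^sub>s\<^sup>* \<circ> T\<^sub>s) \<circ> (T\<^sub>s \<circ> T\<^sub>s\<^sup>*)\<close>, where \<open>T\<^sub>s\<^sup>* \<circ> T\<^sub>s \<le> id \<le> T\<^sub>s \<circ> T\<^sub>s\<^sup>*\<close>.
  The second inequality is an equality on functions that are semi-concave with a constant at
  most \<open>1/s\<close>, and the first one on the negatives of such functions; by monotonicity \<open>R\<^sub>s\<close>
  therefore preserves the order relation to barriers of these two kinds.
  In the charts, \<open>g\<^sub>i u\<close> and \<open>- g\<^sub>i v\<close>, extended by zero, are semi-concave with some constants,
  and \<open>a\<^sub>i\<close> is the inverse of the larger one. The bounds \<open>g\<^sub>i v \<le> G\<^sub>t f \<le> g\<^sub>i u\<close> for the
  \<open>i\<close>-th term force it to vanish with \<open>g\<^sub>i\<close>, whence local finiteness, and sum up to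
  \<open>v \<le> G\<^sub>t f \<le> u\<close>.

  For the regularity, \<open>R\<^sub>s w\<close> is a supremum of paraboloids of opening \<open>-1/s\<close>, hence has a lower
  gradient everywhere, and a midpoint inequality turns the lower gradient into a two-sided
  quadratic approximation. Such approximations are stable under sums and composition with
  smooth maps, and force the gradient to be Lipschitz.
\<close>

section \<open>Inf-convolutions and sup-convolutions\<close>

lemma T_op_lower:
  assumes "\<And>y. c \<le> w y + (norm (y - x))\<^sup>2 / s"
  shows "c \<le> T_op s w x"
  unfolding T_op_def using assms by (intro cINF_greatest) auto

text \<open>The bound from below makes the real-valued infimum a genuine lower bound of its
  competitors; for a family unbounded below \<open>INF\<close> gives no such information. Hence the
  boundedness hypotheses further on.\<close>

lemma T_op_le:
  assumes "\<forall>y. - M \<le> w y" and "s > 0"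
  shows "T_op s w x \<le> w y + (norm (y - x))\<^sup>2 / s"
  unfolding T_op_def
proof (rule cINF_lower)
  have "- M \<le> w y + (norm (y - x))\<^sup>2 / s" for y
    using assms(1)[rule_format, of y] assms(2) by (smt (verit) zero_le_divide_iff zero_le_power2)
  then show "bdd_below (range (\<lambda>y. w y + (norm (y - x))\<^sup>2 / s))"
    by (intro bdd_belowI[of _ "- M"]) auto
qed auto

text \<open>A change of sign exchanges the two convolutions, so the basic facts on sup-convolutions
  are read off from their counterparts for inf-convolutions.\<close>

lemma Tc_op_eq: "Tc_op s w x = - T_op s (\<lambda>y. - w y) x"
proof -
  have "(\<lambda>y. w y - (norm (y - x))\<^sup>2 / s) ` UNIV
      = uminus ` (\<lambda>y. - w y + (norm (y - x))\<^sup>2 / s) ` UNIV"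
    by (auto simp: image_image)
  then show ?thesis
    unfolding T_op_def Tc_op_def by (simp add: Inf_real_def image_image)
qed

lemma Tc_op_upper:
  assumes "\<And>y. w y - (norm (y - x))\<^sup>2 / s \<le> c"
  shows "Tc_op s w x \<le> c"
  using T_op_lower[of "- c" "\<lambda>y. - w y" x s] assms
  by (simp add: Tc_op_eq) (smt (verit, best))

lemma Tc_op_ge:
  assumes "\<forall>y. w y \<le> M" and "s > 0"
  shows "w y - (norm (y - x))\<^sup>2 / s \<le> Tc_op s w x"
  using T_op_le[of M "\<lambda>y. - w y" s x y] assms by (simp add: Tc_op_eq)

lemma T_op_abs_le:
  assumes "\<forall>y. \<bar>w y\<bar> \<le> M" and "s > 0"
  shows "\<bar>T_op s w x\<bar> \<le> M"
proof -
  have lo: "\<forall>y. - M \<le> w y" using assms(1) by (simp add: abs_le_iff minus_le_iff)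
  have "- M \<le> T_op s w x"
    using lo assms(2) by (intro T_op_lower) (smt (verit) zero_le_divide_iff zero_le_power2)
  moreover have "T_op s w x \<le> w x"
    using T_op_le[OF lo assms(2), of x x] by simp
  ultimately show ?thesis using assms(1)[rule_format, of x] by linarith
qed

lemma Tc_op_abs_le:
  assumes "\<forall>y. \<bar>w y\<bar> \<le> M" and "s > 0"
  shows "\<bar>Tc_op s w x\<bar> \<le> M"
  using T_op_abs_le[of "\<lambda>y. - w y" M s x] assms by (simp add: Tc_op_eq)

lemma R_op_abs_le:
  assumes "\<forall>y. \<bar>w y\<bar> \<le> M" and "s > 0"
  shows "\<bar>R_op s w x\<bar> \<le> M"
  unfolding R_op_def using assms by (intro Tc_op_abs_le T_op_abs_le allI) auto

lemma T_op_mono: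
  assumes "\<forall>y. - M \<le> w y" and "s > 0" and "\<And>y. w y \<le> w' y"
  shows "T_op s w x \<le> T_op s w' x"
proof (rule T_op_lower)
  fix y
  show "T_op s w x \<le> w' y + (norm (y - x))\<^sup>2 / s"
    using T_op_le[OF assms(1,2), of x y] assms(3)[of y] by linarith
qed

lemma Tc_op_mono:
  assumes "\<forall>y. w' y \<le> M" and "s > 0" and "\<And>y. w y \<le> w' y"
  shows "Tc_op s w x \<le> Tc_op s w' x"
  using T_op_mono[of M "\<lambda>y. - w' y" s "\<lambda>y. - w y" x] assms by (simp add: Tc_op_eq)

text \<open>This is |a - b|^2 >= 0. In terms of costs: one direct step with parameter 2s is never
  dearer than a detour in two steps with parameter s.\<close>

lemma norm_add_le_midpoint:
  fixes a b :: "'a::real_inner"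
  assumes "s > 0"
  shows "(norm (a + b))\<^sup>2 / (2 * s) \<le> (norm a)\<^sup>2 / s + (norm b)\<^sup>2 / s"
proof -
  have "(norm (a + b))\<^sup>2 \<le> 2 * ((norm a)\<^sup>2 + (norm b)\<^sup>2)"
    using zero_le_power2[of "norm (a - b)"] unfolding power2_norm_eq_inner
    by (simp add: inner_add_left inner_add_right inner_diff_left inner_diff_right inner_commute)
  then show ?thesis using assms by (simp add: field_simps)
qed

text \<open>The cheapest way to split a step of parameter 2s into two of parameter s passes through
  the midpoint, where the costs add up exactly; so the two nested infima collapse into one.\<close>

lemma T_op_semigroup:
  assumes "\<forall>y. \<bar>w y\<bar> \<le> M" and s: "s > 0"
  shows "T_op (2 * s) w = T_op s (T_op s w)"
proof (rule ext, rule antisym)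
  fix x
  have lo: "\<forall>y. - M \<le> w y" using assms(1) by (simp add: abs_le_iff minus_le_iff)
  have lo': "\<forall>y. - M \<le> T_op s w y" using T_op_abs_le[OF assms] by (simp add: abs_le_iff minus_le_iff)
  show "T_op (2 * s) w x \<le> T_op s (T_op s w) x"
  proof (rule T_op_lower)
    fix y
    have "T_op (2 * s) w x - (norm (y - x))\<^sup>2 / s \<le> T_op s w y"
    proof (rule T_op_lower)
      fix z
      have "T_op (2 * s) w x \<le> w z + (norm (z - x))\<^sup>2 / (2 * s)"
        using lo s by (intro T_op_le) auto
      also have "(norm (z - x))\<^sup>2 / (2 * s) \<le> (norm (z - y))\<^sup>2 / s + (norm (y - x))\<^sup>2 / s"
        using norm_add_le_midpoint[OF s, of "z - y" "y - x"] by simp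
      finally show "T_op (2 * s) w x - (norm (y - x))\<^sup>2 / s \<le> w z + (norm (z - y))\<^sup>2 / s"
        by simp
    qed
    then show "T_op (2 * s) w x \<le> T_op s w y + (norm (y - x))\<^sup>2 / s" by simp
  qed
  show "T_op s (T_op s w) x \<le> T_op (2 * s) w x"
  proof (rule T_op_lower)
    fix z
    define y where "y = midpoint x z"
    have zy: "norm (z - y) = norm (z - x) / 2" and yx: "norm (y - x) = norm (z - x) / 2"
      unfolding y_def dist_norm[symmetric] by (simp_all add: dist_midpoint dist_commute)
    have "(norm (z - y))\<^sup>2 / s + (norm (y - x))\<^sup>2 / s = (norm (z - x))\<^sup>2 / (2 * s)"
      unfolding zy yx using s by (simp add: power_divide)
    moreover have "T_op s (T_op s w) x \<le> T_op s w y + (norm (y - x))\<^sup>2 / s"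
      by (rule T_op_le[OF lo' s])
    moreover have "T_op s w y \<le> w z + (norm (z - y))\<^sup>2 / s"
      by (rule T_op_le[OF lo s])
    ultimately show "T_op s (T_op s w) x \<le> w z + (norm (z - x))\<^sup>2 / (2 * s)" by linarith
  qed
qed

section \<open>Order relations for the compositions, and barriers respected by
  \<open>R_op\<close>\<close>

lemma T_Tc_op_ge:
  assumes "\<forall>y. w y \<le> M" and "s > 0"
  shows "w x \<le> T_op s (Tc_op s w) x"
proof (rule T_op_lower)
  fix y
  show "w x \<le> Tc_op s w y + (norm (y - x))\<^sup>2 / s"
    using Tc_op_ge[OF assms, of x y] by (simp add: norm_minus_commute)
qed

lemma Tc_T_op_le:
  assumes "\<forall>y. - M \<le> w y" and "s > 0"
  shows "Tc_op s (T_op s w) x \<le> w x"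
proof (rule Tc_op_upper)
  fix y
  show "T_op s w y - (norm (y - x))\<^sup>2 / s \<le> w x"
    using T_op_le[OF assms, of y x] by (simp add: norm_minus_commute)
qed

text \<open>Each point carries a paraboloid that touches the graph from above and stays above it
  globally. This is the form that the convolutions consume, and it can be checked directly for a
  function cut off and extended by zero.\<close>

definition semiconcave_with :: "real \<Rightarrow> ('a::real_inner \<Rightarrow> real) \<Rightarrow> bool" where
  "semiconcave_with C w \<longleftrightarrow> (\<forall>x. \<exists>p. \<forall>y. w y \<le> w x + p \<bullet> (y - x) + C * (norm (y - x))\<^sup>2)"

text \<open>The touching paraboloid at x may be widened to opening 1/s. Its sup-convolution at its
  vertex y equals its minimum value, w x - |y - x|^2/s, and using y as competitor for x gives the
  penalty back.\<close>

lemma T_Tc_op_le: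
  fixes w :: "real^'n \<Rightarrow> real"
  assumes "\<forall>y. \<bar>w y\<bar> \<le> M" and s: "s > 0" and "semiconcave_with C w" and C: "C \<le> 1 / s"
  shows "T_op s (Tc_op s w) x \<le> w x"
proof -
  obtain p where p: "\<And>y. w y \<le> w x + p \<bullet> (y - x) + C * (norm (y - x))\<^sup>2"
    using assms(3) unfolding semiconcave_with_def by blast
  \<comment> \<open>The vertex of the paraboloid with slope p and opening 1/s at x, found by
    completing the square.\<close>
  define y where "y = x - (s / 2) *\<^sub>R p"
  have lo: "\<forall>z. - M \<le> Tc_op s w z" using Tc_op_abs_le[OF assms(1) s] by (simp add: abs_le_iff minus_le_iff)
  have "Tc_op s w y \<le> w x - (norm (y - x))\<^sup>2 / s"
  proof (rule Tc_op_upper)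
    fix z
    have "w z \<le> w x + p \<bullet> (z - x) + (1 / s) * (norm (z - x))\<^sup>2"
      using p[of z] mult_right_mono[OF C, of "(norm (z - x))\<^sup>2"] by simp
    moreover have "p \<bullet> (z - x) + (1 / s) * (norm (z - x))\<^sup>2 = (norm (z - y))\<^sup>2 / s - (norm (y - x))\<^sup>2 / s"
    proof -
      have zy: "z - y = (z - x) + (s / 2) *\<^sub>R p" and yx: "y - x = - ((s / 2) *\<^sub>R p)"
        by (simp_all add: y_def)
      have "(norm (z - y))\<^sup>2 = (norm (z - x))\<^sup>2 + s * (p \<bullet> (z - x)) + (norm (y - x))\<^sup>2"
        unfolding zy yx power2_norm_eq_inner
        by (simp add: inner_add_left inner_add_right inner_commute algebra_simps)
      then show ?thesis using s by (simp add: field_simps)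
    qed
    ultimately show "w z - (norm (z - y))\<^sup>2 / s \<le> w x - (norm (y - x))\<^sup>2 / s" by linarith
  qed
  then show ?thesis using T_op_le[OF lo s, of x y] by simp
qed

lemma Tc_T_op_ge:
  fixes w :: "real^'n \<Rightarrow> real"
  assumes "\<forall>y. \<bar>w y\<bar> \<le> M" and s: "s > 0" and "semiconcave_with C (\<lambda>x. - w x)" and C: "C \<le> 1 / s"
  shows "w x \<le> Tc_op s (T_op s w) x"
proof -
  have "T_op s (Tc_op s (\<lambda>y. - w y)) x \<le> - w x"
    using assms by (intro T_Tc_op_le[where M = M]) auto
  moreover have "(\<lambda>y. - T_op s w y) = Tc_op s (\<lambda>y. - w y)"
    by (auto simp: Tc_op_eq)
  ultimately show ?thesis by (simp add: Tc_op_eq)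
qed

text \<open>By monotonicity w may be replaced by w'. Writing T_2s as T_s o T_s, semi-concavity
  cancels the inner pair T_s o Tc_s on w'; what remains is Tc_s o T_s, which never exceeds the
  identity.\<close>

lemma R_op_le:
  fixes w :: "real^'n \<Rightarrow> real"
  assumes w: "\<forall>y. \<bar>w y\<bar> \<le> M" and w': "\<forall>y. \<bar>w' y\<bar> \<le> M" and s: "s > 0"
    and "semiconcave_with C w'" and C: "C \<le> 1 / s" and le: "\<And>y. w y \<le> w' y"
  shows "R_op s w x \<le> w' x"
proof -
  have b: "\<forall>y. \<bar>Tc_op s w y\<bar> \<le> M" "\<forall>y. \<bar>Tc_op s w' y\<bar> \<le> M"
    using Tc_op_abs_le[OF w s] Tc_op_abs_le[OF w' s] by auto
  have up: "\<forall>y. w' y \<le> M" "\<forall>y. - M \<le> w' y" using w' by (auto simp: abs_le_iff minus_le_iff)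
  have 1: "Tc_op s w y \<le> Tc_op s w' y" for y
    using up le s by (intro Tc_op_mono) auto
  have lo: "\<forall>y. - M \<le> Tc_op s w y" using b(1) by (simp add: abs_le_iff minus_le_iff)
  have lo2: "\<forall>y. - M \<le> T_op s (Tc_op s w') y"
    using T_op_abs_le[OF b(2) s] by (simp add: abs_le_iff minus_le_iff)
  have 2: "T_op (2 * s) (Tc_op s w) y \<le> T_op s w' y" for y
  proof -
    have "T_op (2 * s) (Tc_op s w) y \<le> T_op (2 * s) (Tc_op s w') y"
      using lo 1 s by (intro T_op_mono) auto
    also have "\<dots> = T_op s (T_op s (Tc_op s w')) y"
      by (simp add: T_op_semigroup[OF b(2) s])
    also have "\<dots> \<le> T_op s w' y"
      using T_Tc_op_le[OF w' s assms(4) C] lo2 s by (intro T_op_mono) auto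
    finally show ?thesis .
  qed
  have up2: "\<forall>y. T_op s w' y \<le> M" using T_op_abs_le[OF w' s] by (simp add: abs_le_iff)
  have "R_op s w x \<le> Tc_op s (T_op s w') x"
    unfolding R_op_def using 2 up2 s by (intro Tc_op_mono) auto
  also have "\<dots> \<le> w' x" by (rule Tc_T_op_le[OF up(2) s])
  finally show ?thesis .
qed

text \<open>Here the inner pair T_s o Tc_s only increases w, and the outer pair Tc_s o T_s fixes the
  lower barrier from below by semi-concavity of -w'.\<close>

lemma R_op_ge:
  fixes w :: "real^'n \<Rightarrow> real"
  assumes w: "\<forall>y. \<bar>w y\<bar> \<le> M" and w': "\<forall>y. \<bar>w' y\<bar> \<le> M" and s: "s > 0"
    and "semiconcave_with C (\<lambda>x. - w' x)" and C: "C \<le> 1 / s" and le: "\<And>y. w' y \<le> w y"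
  shows "w' x \<le> R_op s w x"
proof -
  have b: "\<forall>y. \<bar>Tc_op s w y\<bar> \<le> M" using Tc_op_abs_le[OF w s] by blast
  have up: "\<forall>y. w y \<le> M" "\<forall>y. - M \<le> w' y" using w w' by (auto simp: abs_le_iff minus_le_iff)
  have 1: "w' y \<le> T_op s (Tc_op s w) y" for y
    using order_trans[OF le[of y] T_Tc_op_ge[OF up(1) s, of y]] .
  have 2: "T_op s w' y \<le> T_op (2 * s) (Tc_op s w) y" for y
    unfolding T_op_semigroup[OF b s] using up 1 s by (intro T_op_mono) auto
  have "\<forall>y. T_op (2 * s) (Tc_op s w) y \<le> M"
    using T_op_abs_le[OF b, of "2 * s"] s by (simp add: abs_le_iff)
  then have "Tc_op s (T_op s w') x \<le> R_op s w x"
    unfolding R_op_def using 2 s by (intro Tc_op_mono) auto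
  with Tc_T_op_ge[OF w' s assms(4) C] show ?thesis by (rule order_trans)
qed

section \<open>Supporting paraboloids and the gradient of \<open>R_op\<close>\<close>

lemma concave_supergradient:
  fixes f :: "'a::euclidean_space \<Rightarrow> real"
  assumes f: "concave_on S f" and S: "open S" "convex S" and x: "x \<in> S"
  shows "\<exists>p. \<forall>y\<in>S. f y \<le> f x + p \<bullet> (y - x)"
proof -
  \<comment> \<open>The strict hypograph is convex and misses (x, f x), so a hyperplane separates
    the two; its slope will be the supergradient.\<close>
  define H where "H = {z. fst z \<in> S \<and> snd z < f (fst z)}"
  have "convex H"
    unfolding convex_def
  proof (intro ballI allI impI)
    fix z z' and l m :: real
    assume zz: "z \<in> H" "z' \<in> H" and l: "0 \<le> l" "0 \<le> m" "l + m = 1"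
    have "l * snd z + m * snd z' < l * f (fst z) + m * f (fst z')"
    proof (cases "l = 0")
      case False
      then have "l * snd z < l * f (fst z)" using l zz by (auto simp: H_def)
      moreover have "m * snd z' \<le> m * f (fst z')" using l zz by (auto simp: H_def intro: mult_left_mono)
      ultimately show ?thesis by linarith
    qed (use l zz in \<open>auto simp: H_def\<close>)
    also have "\<dots> \<le> f (l *\<^sub>R fst z + m *\<^sub>R fst z')"
      using f zz l unfolding concave_on_iff H_def by auto
    finally show "l *\<^sub>R z + m *\<^sub>R z' \<in> H"
      using S(2) zz l unfolding H_def convex_def by auto
  qed
  moreover have "H \<noteq> {}" "{(x, f x)} \<inter> H = {}"
    using x by (auto simp: H_def intro!: exI[of _ x] exI[of _ "f x - 1"])
  ultimately obtain a b where a: "a \<noteq> 0" "a \<bullet> (x, f x) \<le> b" "\<And>z. z \<in> H \<Longrightarrow> b \<le> a \<bullet> z"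
    using separating_hyperplane_sets[of "{(x, f x)}" H] by (metis convex_singleton singletonI insert_not_empty)
  obtain p \<alpha> where p: "a = (p, \<alpha>)" by (cases a)
  have sep: "p \<bullet> x + \<alpha> * f x \<le> p \<bullet> y + \<alpha> * t" if "y \<in> S" "t < f y" for y t
    using a(2) a(3)[of "(y, t)"] that by (simp add: p H_def)
  have "\<alpha> \<le> 0"
    using sep[OF x, of "f x - 1"] by (simp add: algebra_simps)
  \<comment> \<open>A vertical hyperplane is impossible: since S is open, one can move from x
    against p and stay in S, which decreases p . y below p . x.\<close>
  have "\<alpha> \<noteq> 0"
  proof
    assume [simp]: "\<alpha> = 0"
    obtain e where e: "e > 0" "cball x e \<subseteq> S" using S x open_contains_cball by blast
    have "p \<noteq> 0" using a(1) p by (auto simp: zero_prod_def)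
    define y where "y = x - (e / norm p) *\<^sub>R p"
    have "y \<in> S" using e \<open>p \<noteq> 0\<close> by (intro subsetD[OF e(2)]) (simp add: y_def dist_norm)
    then have "p \<bullet> x \<le> p \<bullet> y" using sep[of y "f y - 1"] by simp
    then have "(e / norm p) * (p \<bullet> p) \<le> 0" by (simp add: y_def inner_simps)
    then show False using e \<open>p \<noteq> 0\<close>
      by (smt (verit) divide_pos_pos inner_gt_zero_iff mult_pos_pos zero_less_norm_iff)
  qed
  with \<open>\<alpha> \<le> 0\<close> have neg: "\<alpha> < 0" by simp
  have "f y \<le> f x + (- p /\<^sub>R \<alpha>) \<bullet> (y - x)" if "y \<in> S" for y
  proof (rule dense_le)
    fix t assume "t < f y"
    from sep[OF that this] have "\<alpha> * (f x - t) \<le> p \<bullet> (y - x)" by (simp add: algebra_simps)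
    then have "f x - t \<ge> (p \<bullet> (y - x)) / \<alpha>" using neg by (simp add: field_simps)
    then show "t \<le> f x + (- p /\<^sub>R \<alpha>) \<bullet> (y - x)" by (simp add: divide_inverse mult.commute)
  qed
  then show ?thesis by blast
qed

text \<open>
  In \<open>T\<^sub>s\<^sup>* k\<close> with \<open>k\<close> in the range of \<open>T\<^bsub>2s\<^esub>\<close>, the competitors \<open>y\<^sub>1\<close> for \<open>x + h\<close> and \<open>y\<^sub>2\<close> for
  \<open>x - h\<close> are compared with their midpoint as competitor for \<open>x\<close>: the opening \<open>1/(2s)\<close> of the
  paraboloids in \<open>k\<close> is absorbed by the strictly larger \<open>1/s\<close>.
\<close>

lemma R_op_midpoint:
  fixes w :: "real^'n \<Rightarrow> real"
  assumes w: "\<forall>y. \<bar>w y\<bar> \<le> M" and s: "s > 0"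
  shows "R_op s w (x + h) + R_op s w (x - h) \<le> 2 * R_op s w x + 2 * (norm h)\<^sup>2 / s"
proof -
  define k where "k = T_op (2 * s) (Tc_op s w)"
  have b': "\<forall>y. \<bar>Tc_op s w y\<bar> \<le> M" using Tc_op_abs_le[OF w s] by blast
  then have b: "\<forall>y. - M \<le> Tc_op s w y" by (simp add: abs_le_iff minus_le_iff)
  have kM: "\<forall>y. k y \<le> M" unfolding k_def
    using T_op_abs_le[OF b', of "2 * s"] s by (simp add: abs_le_iff)
  \<comment> \<open>Each paraboloid |z - .|^2/(2s) satisfies the midpoint relation with defect
    exactly |y1 - y2|^2/(4s); the infimum of such functions inherits it as an inequality.\<close>
  have kmid: "k y1 + k y2 - (norm (y1 - y2))\<^sup>2 / (4 * s) \<le> 2 * k ((y1 + y2) /\<^sub>R 2)" for y1 y2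
  proof -
    have "(k y1 + k y2 - (norm (y1 - y2))\<^sup>2 / (4 * s)) / 2 \<le> T_op (2 * s) (Tc_op s w) ((y1 + y2) /\<^sub>R 2)"
    proof (rule T_op_lower)
      fix z
      have "k y1 \<le> Tc_op s w z + (norm (z - y1))\<^sup>2 / (2 * s)"
        "k y2 \<le> Tc_op s w z + (norm (z - y2))\<^sup>2 / (2 * s)"
        unfolding k_def using b s by (auto intro!: T_op_le)
      moreover have "(norm (z - y1))\<^sup>2 / (2 * s) + (norm (z - y2))\<^sup>2 / (2 * s) =
          2 * ((norm (z - (y1 + y2) /\<^sub>R 2))\<^sup>2 / (2 * s)) + (norm (y1 - y2))\<^sup>2 / (4 * s)"
      proof -
        have "(norm (z - y1))\<^sup>2 + (norm (z - y2))\<^sup>2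
          = 2 * (norm (z - (y1 + y2) /\<^sub>R 2))\<^sup>2 + (norm (y1 - y2))\<^sup>2 / 2"
          unfolding power2_norm_eq_inner by (simp add: inner_simps inner_commute field_simps)
        then show ?thesis using s by (simp only: add_divide_distrib[symmetric]) (simp add: add_divide_distrib)
      qed
      moreover have "(a + b - e) / 2 \<le> t + r"
        if "a \<le> t + p" "b \<le> t + q" "p + q = 2 * r + e" for a b e t r p q :: real
        using that by (simp add: field_simps)
      ultimately show "(k y1 + k y2 - (norm (y1 - y2))\<^sup>2 / (4 * s)) / 2
        \<le> Tc_op s w z + (norm (z - (y1 + y2) /\<^sub>R 2))\<^sup>2 / (2 * s)" by blast
    qed
    then show ?thesis by (simp add: k_def)
  qed
  have R: "R_op s w = Tc_op s k" by (simp add: R_op_def k_def)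
  have pair: "(k y1 - (norm (y1 - (x + h)))\<^sup>2 / s) + (k y2 - (norm (y2 - (x - h)))\<^sup>2 / s)
      \<le> 2 * R_op s w x + 2 * (norm h)\<^sup>2 / s" for y1 y2
  proof -
    define m where "m = (y1 + y2) /\<^sub>R 2"
    define e where "e = y1 - y2"
    have y: "y1 = m + e /\<^sub>R 2" "y2 = m - e /\<^sub>R 2"
      by (simp_all add: m_def e_def vec_eq_iff field_simps)
    have "k m - (norm (m - x))\<^sup>2 / s \<le> R_op s w x"
      unfolding R by (rule Tc_op_ge[OF kM s])
    moreover have "k y1 + k y2 - (norm e)\<^sup>2 / (4 * s) \<le> 2 * k m"
      using kmid[of y1 y2] by (simp add: m_def e_def)
    moreover have "(norm e)\<^sup>2 / (4 * s) - (norm (y1 - (x + h)))\<^sup>2 / s - (norm (y2 - (x - h)))\<^sup>2 / s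
       \<le> 2 * (norm h)\<^sup>2 / s - 2 * (norm (m - x))\<^sup>2 / s"
    proof -
      \<comment> \<open>This square is exactly the gap in the claim: the displacements from x + h
        and x - h are (m - x) plus and minus (e/2 - h), and |e/2|^2 <= 2 |e/2 - h|^2 + 2
        |h|^2.\<close>
      have "0 \<le> (norm (e /\<^sub>R 2 - 2 *\<^sub>R h))\<^sup>2" by simp
      then have "(norm e)\<^sup>2 / 4 - (norm (y1 - (x + h)))\<^sup>2 - (norm (y2 - (x - h)))\<^sup>2
         \<le> 2 * (norm h)\<^sup>2 - 2 * (norm (m - x))\<^sup>2"
        unfolding power2_norm_eq_inner y by (simp add: inner_simps inner_commute field_simps)
      from divide_right_mono[OF this, of s] show ?thesis
        using s by (simp add: diff_divide_distrib mult.commute)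
    qed
    ultimately show ?thesis by (simp add: algebra_simps)
  qed
  \<comment> \<open>The bound holds for each pair of competitors; the suprema are taken one after
    the other, over y2 with y1 fixed and then over y1.\<close>
  have "R_op s w (x + h) \<le> 2 * R_op s w x + 2 * (norm h)\<^sup>2 / s - R_op s w (x - h)"
  proof (subst R, rule Tc_op_upper)
    fix y1
    have "R_op s w (x - h) \<le> 2 * R_op s w x + 2 * (norm h)\<^sup>2 / s - (k y1 - (norm (y1 - (x + h)))\<^sup>2 / s)"
      by (subst R, rule Tc_op_upper) (use pair in \<open>smt (verit)\<close>)
    then show "k y1 - (norm (y1 - (x + h)))\<^sup>2 / s
      \<le> 2 * R_op s w x + 2 * (norm h)\<^sup>2 / s - R_op s w (x - h)" by linarith
  qed
  then show ?thesis by simp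
qed

text \<open>Expanding the square shows that \<open>Tc_op s k\<close> plus |.|^2/s is a supremum of
  affine functions, hence convex. A supergradient of its negative gives the supporting paraboloid
  from below.\<close>

lemma Tc_op_lower_gradient:
  fixes k :: "real^'n \<Rightarrow> real"
  assumes k: "\<forall>y. k y \<le> M" and s: "s > 0"
  shows "\<exists>p. \<forall>y. Tc_op s k x + p \<bullet> (y - x) - (norm (y - x))\<^sup>2 / s \<le> Tc_op s k y"
proof -
  define F where "F y = - Tc_op s k y - (norm y)\<^sup>2 / s" for y
  have "concave_on UNIV F"
    unfolding concave_on_iff
  proof (safe intro!: convex_UNIV)
    fix y1 y2 :: "real^'n" and l m :: real
    assume lm: "0 \<le> l" "0 \<le> m" "l + m = 1"
    define y where "y = l *\<^sub>R y1 + m *\<^sub>R y2"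
    have "Tc_op s k y \<le> - (norm y)\<^sup>2 / s - (l * F y1 + m * F y2)"
    proof (rule Tc_op_upper)
      fix z
      have aff: "k z - (norm (z - v))\<^sup>2 / s + (norm v)\<^sup>2 / s = k z - (norm z)\<^sup>2 / s + 2 / s * (z \<bullet> v)" for v
        unfolding power2_norm_eq_inner using s by (simp add: inner_simps inner_commute field_simps)
      have F: "k z - (norm z)\<^sup>2 / s + 2 / s * (z \<bullet> v) \<le> - F v" for v
        using Tc_op_ge[OF k s, of z v] unfolding aff[symmetric] by (simp add: F_def)
      have "k z - (norm (z - y))\<^sup>2 / s + (norm y)\<^sup>2 / s = k z - (norm z)\<^sup>2 / s + 2 / s * (z \<bullet> y)"
        by (rule aff)
      also have "\<dots> = l * (k z - (norm z)\<^sup>2 / s + 2 / s * (z \<bullet> y1)) + m * (k z - (norm z)\<^sup>2 / s + 2 / s * (z \<bullet> y2))"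
      proof -
        have m: "m = 1 - l" using lm by simp
        have "z \<bullet> y = l * (z \<bullet> y1) + (1 - l) * (z \<bullet> y2)"
          unfolding y_def m by (simp add: inner_simps)
        then show ?thesis unfolding m by algebra
      qed
      also have "\<dots> \<le> l * (- F y1) + m * (- F y2)"
        using F lm by (intro add_mono mult_left_mono) auto
      finally show "k z - (norm (z - y))\<^sup>2 / s \<le> - (norm y)\<^sup>2 / s - (l * F y1 + m * F y2)"
        by simp
    qed
    then show "l * F y1 + m * F y2 \<le> F (l *\<^sub>R y1 + m *\<^sub>R y2)"
      by (simp add: F_def flip: y_def)
  qed
  then obtain q where q: "\<And>y. F y \<le> F x + q \<bullet> (y - x)"
    using concave_supergradient[of UNIV F x] by auto
  \<comment> \<open>The term (2/s) x recentres the quadratic |.|^2/s from the origin to x.\<close>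
  have "Tc_op s k x + (- q - (2 / s) *\<^sub>R x) \<bullet> (y - x) - (norm (y - x))\<^sup>2 / s \<le> Tc_op s k y" for y
  proof -
    have "(norm y)\<^sup>2 / s - (norm x)\<^sup>2 / s = (2 / s) * (x \<bullet> (y - x)) + (norm (y - x))\<^sup>2 / s"
      unfolding power2_norm_eq_inner using s by (simp add: inner_simps inner_commute field_simps)
    moreover have "(- q - (2 / s) *\<^sub>R x) \<bullet> (y - x) = - (q \<bullet> (y - x)) - (2 / s) * (x \<bullet> (y - x))"
      by (simp only: inner_diff_left inner_minus_left inner_scaleR_left)
    ultimately show ?thesis using q[of y] unfolding F_def by linarith
  qed
  then show ?thesis by blast
qed

text \<open>The lower paraboloid evaluated at x - h, inserted in the midpoint inequality, bounds the
  value at x + h from above. The constant 3/s is 2/s from the midpoint inequality plus 1/s from the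
  paraboloid.\<close>

lemma R_op_gradient:
  fixes w :: "real^'n \<Rightarrow> real"
  assumes w: "\<forall>y. \<bar>w y\<bar> \<le> M" and s: "s > 0"
  shows "\<exists>p. \<forall>x y. \<bar>R_op s w y - R_op s w x - p x \<bullet> (y - x)\<bar> \<le> 3 / s * (norm (y - x))\<^sup>2"
proof -
  have "\<forall>y. \<bar>Tc_op s w y\<bar> \<le> M" using Tc_op_abs_le[OF w s] by blast
  then have "\<forall>y. T_op (2 * s) (Tc_op s w) y \<le> M"
    using T_op_abs_le[of "Tc_op s w" M "2 * s"] s by (simp add: abs_le_iff)
  from Tc_op_lower_gradient[OF this s]
  have "\<forall>x. \<exists>p. \<forall>y. R_op s w x + p \<bullet> (y - x) - (norm (y - x))\<^sup>2 / s \<le> R_op s w y"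
    by (simp add: R_op_def)
  then obtain p where p: "\<And>x y. R_op s w x + p x \<bullet> (y - x) - (norm (y - x))\<^sup>2 / s \<le> R_op s w y"
    by metis
  have "\<bar>R_op s w y - R_op s w x - p x \<bullet> (y - x)\<bar> \<le> 3 / s * (norm (y - x))\<^sup>2" for x y
  proof -
    define h where "h = y - x"
    have y: "y = x + h" by (simp add: h_def)
    have "R_op s w (x + h) + R_op s w (x - h) \<le> 2 * R_op s w x + 2 * (norm h)\<^sup>2 / s"
      by (rule R_op_midpoint[OF w s])
    moreover have "R_op s w x + p x \<bullet> h - (norm h)\<^sup>2 / s \<le> R_op s w (x + h)"
      "R_op s w x - p x \<bullet> h - (norm h)\<^sup>2 / s \<le> R_op s w (x - h)"
      using p[of x "x + h"] p[of x "x - h"] by simp_all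
    moreover have "0 \<le> (norm h)\<^sup>2 / s" using s by simp
    ultimately show ?thesis unfolding y abs_le_iff by simp
  qed
  then show ?thesis by blast
qed

section \<open>Convergence of \<open>R_op\<close> as its parameter tends to zero\<close>

lemma T_op_approx:
  fixes w :: "real^'n \<Rightarrow> real"
  assumes w: "\<forall>y. \<bar>w y\<bar> \<le> M" and s: "0 < s" "2 * M * s \<le> \<delta>\<^sup>2" and \<delta>: "\<delta> > 0" and \<epsilon>: "\<epsilon> > 0"
    and uc: "\<And>x y. norm (y - x) < \<delta> \<Longrightarrow> \<bar>w y - w x\<bar> \<le> \<epsilon>"
  shows "w x - \<epsilon> \<le> T_op s w x"
proof (rule T_op_lower)
  fix y
  show "w x - \<epsilon> \<le> w y + (norm (y - x))\<^sup>2 / s"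
  proof (cases "norm (y - x) < \<delta>")
    case True
    moreover have "0 \<le> (norm (y - x))\<^sup>2 / s" using s by simp
    ultimately show ?thesis using uc[of y x] by linarith
  next
    \<comment> \<open>A competitor at distance at least \<open>\<delta>\<close> pays at least 2 M,
      which covers the whole oscillation of w.\<close>
    case False
    then have "2 * M * s \<le> (norm (y - x))\<^sup>2"
      using s \<delta> by (smt (verit) power_mono)
    then have "2 * M \<le> (norm (y - x))\<^sup>2 / s" using s by (simp add: field_simps)
    then show ?thesis using w[rule_format, of x] w[rule_format, of y] \<epsilon> by linarith
  qed
qed

text \<open>The factor 4 instead of 2 allows for the middle operator, whose parameter is 2s. From
  above, both sup-convolutions can cost \<open>\<epsilon>\<close>; from below, only the
  inf-convolution does.\<close>

lemma R_op_approx: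
  fixes w :: "real^'n \<Rightarrow> real"
  assumes w: "\<forall>y. \<bar>w y\<bar> \<le> M" and s: "0 < s" "4 * M * s \<le> \<delta>\<^sup>2" and \<delta>: "\<delta> > 0" and \<epsilon>: "\<epsilon> > 0"
    and uc: "\<And>x y. norm (y - x) < \<delta> \<Longrightarrow> \<bar>w y - w x\<bar> \<le> \<epsilon>"
  shows "\<bar>R_op s w x - w x\<bar> \<le> 2 * \<epsilon>"
proof -
  have "M \<ge> 0" using w[rule_format, of undefined] by linarith
  then have s': "2 * M * s \<le> \<delta>\<^sup>2" "2 * M * (2 * s) \<le> \<delta>\<^sup>2" 
    using s by (auto intro: order_trans[OF _ s(2)])
  have up: "Tc_op s w y \<le> w y + \<epsilon>" for y
  proof -
    have "- w y - \<epsilon> \<le> T_op s (\<lambda>y. - w y) y"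
    proof (rule T_op_approx[where M = M and \<delta> = \<delta>])
      show "\<bar>- w z - - w x\<bar> \<le> \<epsilon>" if "norm (z - x) < \<delta>" for x z
        using uc[OF that] by linarith
    qed (use w s(1) s'(1) \<delta> \<epsilon> in auto)
    then show ?thesis by (simp add: Tc_op_eq)
  qed
  have wM: "\<forall>y. w y \<le> M" "\<forall>y. - M \<le> w y" using w by (auto simp: abs_le_iff minus_le_iff)
  have TcM: "\<forall>y. \<bar>Tc_op s w y\<bar> \<le> M" "\<forall>y. - M \<le> Tc_op s w y"
    using Tc_op_abs_le[OF w s(1)] by (auto simp: abs_le_iff minus_le_iff)
  have lo: "w y \<le> Tc_op s w y" for y using Tc_op_ge[OF wM(1) s(1), of y y] by simp
  let ?k = "T_op (2 * s) (Tc_op s w)"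
  have k1: "?k y \<le> w y + \<epsilon>" for y
    using T_op_le[OF TcM(2), of "2 * s" y y] up[of y] s by simp
  have k2: "w y - \<epsilon> \<le> ?k y" for y
  proof -
    have "w y - \<epsilon> \<le> T_op (2 * s) w y"
      using w s(1) s'(2) \<delta> \<epsilon> uc by (intro T_op_approx[where M = M and \<delta> = \<delta>]) auto
    also have "\<dots> \<le> ?k y" using wM(2) lo s by (intro T_op_mono) auto
    finally show ?thesis .
  qed
  have kM: "\<forall>y. ?k y \<le> M"
    using T_op_abs_le[OF TcM(1), of "2 * s"] s by (simp add: abs_le_iff)
  have "w x - \<epsilon> \<le> R_op s w x"
    unfolding R_op_def using Tc_op_ge[OF kM s(1), of x x] k2[of x] by simp
  moreover have "R_op s w x \<le> w x + 2 * \<epsilon>"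
    unfolding R_op_def
  proof (rule Tc_op_upper)
    fix y
    show "?k y - (norm (y - x))\<^sup>2 / s \<le> w x + 2 * \<epsilon>"
      using Tc_op_ge[OF wM(1) s(1), of y x] up[of x] k1[of y] by simp
  qed
  ultimately show ?thesis using \<epsilon> by (simp add: abs_le_iff)
qed

section \<open>Quadratic approximation and Lipschitz gradients\<close>

lemma linear_norm_le_Basis:
  fixes l :: "'a::euclidean_space \<Rightarrow> 'b::real_normed_vector" and M :: real
  assumes "linear l" and "\<And>b. b \<in> Basis \<Longrightarrow> norm (l b) \<le> M"
  shows "norm (l h) \<le> DIM('a) * M * norm h"
proof -
  have "l h = l (\<Sum>b\<in>Basis. (h \<bullet> b) *\<^sub>R b)" by (simp add: euclidean_representation)
  also have "\<dots> = (\<Sum>b\<in>Basis. (h \<bullet> b) *\<^sub>R l b)"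
    using assms(1) by (simp add: linear_sum linear_scale)
  also have "norm \<dots> \<le> (\<Sum>b\<in>(Basis::'a set). M * norm h)"
  proof (rule sum_norm_le)
    fix b :: 'a assume "b \<in> Basis"
    then have "norm (l b) * \<bar>h \<bullet> b\<bar> \<le> M * norm h"
      using assms(2) Basis_le_norm by (intro mult_mono) (auto intro: order_trans[OF norm_ge_zero])
    then show "norm ((h \<bullet> b) *\<^sub>R l b) \<le> M * norm h" by (simp add: mult.commute)
  qed
  finally show ?thesis by simp
qed

text \<open>The Lipschitz condition on the derivative is replaced by a uniform quadratic remainder,
  from which it is recovered in \<open>C11_bound_lipschitz\<close>. Sums and compositions then need
  only remainder estimates.\<close>

definition C11_bound ::
  "real \<Rightarrow> 'a::real_normed_vector set \<Rightarrow> ('a \<Rightarrow> 'b::real_normed_vector) \<Rightarrow> ('a \<Rightarrow> 'a \<Rightarrow> 'b) \<Rightarrow> bool" where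
  "C11_bound C V f f' \<longleftrightarrow> (\<forall>x\<in>V. linear (f' x) \<and> (\<forall>h. norm (f' x h) \<le> C * norm h) \<and>
     (\<forall>y\<in>V. norm (f y - f x - f' x (y - x)) \<le> C * (norm (y - x))\<^sup>2))"

definition C11_at :: "('a::real_normed_vector \<Rightarrow> 'b::real_normed_vector) \<Rightarrow> 'a \<Rightarrow> bool" where
  "C11_at f x \<longleftrightarrow> (\<exists>r>0. \<exists>C\<ge>0. \<exists>f'. C11_bound C (ball x r) f f')"

lemma C11_bound_mono:
  assumes "C11_bound C V f f'" and "C \<le> D" and "W \<subseteq> V"
  shows "C11_bound D W f f'"
  unfolding C11_bound_def
proof (intro ballI conjI allI)
  fix x assume x: "x \<in> W"
  then have xV: "x \<in> V" using assms(3) by auto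
  show "linear (f' x)" using assms(1) xV by (auto simp: C11_bound_def)
  show "norm (f' x h) \<le> D * norm h" for h
    using assms(1) xV by (intro order_trans[OF _ mult_right_mono[OF assms(2)]]) (auto simp: C11_bound_def)
  show "norm (f y - f x - f' x (y - x)) \<le> D * (norm (y - x))\<^sup>2" if "y \<in> W" for y
    using assms(1,3) xV that
    by (intro order_trans[OF _ mult_right_mono[OF assms(2)]]) (auto simp: C11_bound_def)
qed

lemma C11_at_const: "C11_at (\<lambda>_. c) x"
  unfolding C11_at_def C11_bound_def
  by (rule exI[of _ 1], simp, rule exI[of _ 0], simp, rule exI[of _ "\<lambda>_ _. 0"], simp add: linear_zero)

lemma C11_at_cong:
  assumes "C11_at f x" and "open N" "x \<in> N" and eq: "\<And>y. y \<in> N \<Longrightarrow> g y = f y"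
  shows "C11_at g x"
proof -
  obtain r C f' where r: "r > 0" "C \<ge> 0" and f: "C11_bound C (ball x r) f f'"
    using assms(1) by (auto simp: C11_at_def)
  obtain e where e: "e > 0" "ball x e \<subseteq> N" using assms(2,3) openE by blast
  have "C11_bound C (ball x (min r e)) f f'" by (rule C11_bound_mono[OF f]) auto
  then have "C11_bound C (ball x (min r e)) g f'"
    using e(2) eq by (auto simp: C11_bound_def subset_eq)
  then show ?thesis unfolding C11_at_def using r e(1) by (metis min_less_iff_conj)
qed

lemma C11_at_add:
  assumes "C11_at f x" and "C11_at g x"
  shows "C11_at (\<lambda>y. f y + g y) x"
proof -
  obtain r C f' where r: "r > 0" "C \<ge> 0" and f: "C11_bound C (ball x r) f f'"
    using assms(1) by (auto simp: C11_at_def)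
  obtain q D g' where q: "q > 0" "D \<ge> 0" and g: "C11_bound D (ball x q) g g'"
    using assms(2) by (auto simp: C11_at_def)
  define W where "W = ball x (min r q)"
  have f: "C11_bound C W f f'" and g: "C11_bound D W g g'"
    using C11_bound_mono[OF f, of C W] C11_bound_mono[OF g, of D W] by (simp_all add: W_def subset_ball)
  have "C11_bound (C + D) W (\<lambda>y. f y + g y) (\<lambda>y h. f' y h + g' y h)"
    unfolding C11_bound_def
  proof (intro ballI conjI allI)
    fix y assume y: "y \<in> W"
    show "linear (\<lambda>h. f' y h + g' y h)"
      using f g y by (intro linear_compose_add) (auto simp: C11_bound_def)
    show "norm (f' y h + g' y h) \<le> (C + D) * norm h" for h
      unfolding distrib_right using f g y by (intro norm_triangle_mono) (auto simp: C11_bound_def)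
    show "norm (f z + g z - (f y + g y) - (f' y (z - y) + g' y (z - y))) \<le> (C + D) * (norm (z - y))\<^sup>2"
      if z: "z \<in> W" for z
    proof -
      have "f z + g z - (f y + g y) - (f' y (z - y) + g' y (z - y))
        = (f z - f y - f' y (z - y)) + (g z - g y - g' y (z - y))" by simp
      then show ?thesis unfolding distrib_right using f g y z
        by (simp only:) (intro norm_triangle_mono, auto simp: C11_bound_def)
    qed
  qed
  then show ?thesis unfolding C11_at_def W_def using r q
    by (metis add_nonneg_nonneg min_less_iff_conj)
qed

lemma C11_at_sum:
  assumes "finite F" and "\<And>i. i \<in> F \<Longrightarrow> C11_at (f i) x"
  shows "C11_at (\<lambda>y. \<Sum>i\<in>F. f i y) x"
  using assms by (induction F rule: finite_induct) (auto simp: C11_at_const intro!: C11_at_add)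

text \<open>The remainder of the composite is the remainder of F along the increment of
  \<open>\<psi>\<close>, plus the derivative of F applied to the remainder of \<open>\<psi>\<close>.
  The first is quadratic because \<open>\<psi>\<close> is Lipschitz near x.\<close>

lemma C11_at_compose:
  assumes "C11_at \<psi> x" and "C11_at F (\<psi> x)"
  shows "C11_at (\<lambda>y. F (\<psi> y)) x"
proof -
  obtain r C \<psi>' where r: "r > 0" "C \<ge> 0" and \<psi>: "C11_bound C (ball x r) \<psi> \<psi>'"
    using assms(1) by (auto simp: C11_at_def)
  obtain q D F' where q: "q > 0" "D \<ge> 0" and F: "C11_bound D (ball (\<psi> x) q) F F'"
    using assms(2) by (auto simp: C11_at_def)
  \<comment> \<open>A Lipschitz constant of \<open>\<psi>\<close> on the ball: C from the
    derivative, and 2 r C from the remainder, as distances there are at most 2 r.\<close>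
  define K where "K = C * (1 + 2 * r)"
  \<comment> \<open>Small enough for \<open>\<psi>\<close> to map the ball into the domain of F; K +
    1 keeps the quotient meaningful if K = 0 and the inclusion strict.\<close>
  define e where "e = min r (q / (K + 1))"
  have K: "K \<ge> 0" using r by (simp add: K_def)
  have e: "e > 0" "e \<le> r" "K * e < q" 
  proof -
    show "e > 0" "e \<le> r" using r q K by (auto simp: e_def)
    have "K * e < (K + 1) * e" using \<open>e > 0\<close> by simp
    also have "\<dots> \<le> (K + 1) * (q / (K + 1))" using K by (intro mult_left_mono) (auto simp: e_def)
    finally show "K * e < q" using K by simp
  qed
  have lip: "norm (\<psi> z - \<psi> y) \<le> K * norm (z - y)" if "y \<in> ball x r" "z \<in> ball x r" for y z
  proof -
    have "norm (z - y) \<le> 2 * r"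
      using that dist_triangle3[of z y x] by (simp add: dist_norm)
    then have "(norm (z - y))\<^sup>2 \<le> 2 * r * norm (z - y)"
      unfolding power2_eq_square by (intro mult_right_mono) auto
    then have "C * (norm (z - y))\<^sup>2 \<le> C * (2 * r * norm (z - y))" using r(2) by (rule mult_left_mono)
    moreover have "norm (\<psi> z - \<psi> y - \<psi>' y (z - y)) \<le> C * (norm (z - y))\<^sup>2"
      "norm (\<psi>' y (z - y)) \<le> C * norm (z - y)"
      using \<psi> that by (auto simp: C11_bound_def)
    moreover have "norm (\<psi> z - \<psi> y) \<le> norm (\<psi> z - \<psi> y - \<psi>' y (z - y)) + norm (\<psi>' y (z - y))"
      by (metis diff_add_cancel norm_triangle_ineq)
    ultimately show ?thesis by (simp add: K_def algebra_simps)
  qed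
  have in_ball: "\<psi> y \<in> ball (\<psi> x) q" if "y \<in> ball x e" for y
  proof -
    have "norm (\<psi> y - \<psi> x) \<le> K * norm (y - x)" using lip[of x y] that e r by auto
    also have "\<dots> \<le> K * e" using that K by (intro mult_left_mono) (auto simp: dist_norm norm_minus_commute)
    finally show ?thesis using e(3) by (simp add: dist_norm norm_minus_commute)
  qed
  have "C11_bound (D * C + D * K\<^sup>2) (ball x e) (\<lambda>y. F (\<psi> y)) (\<lambda>y h. F' (\<psi> y) (\<psi>' y h))"
    unfolding C11_bound_def
  proof (intro ballI conjI allI)
    fix y assume y: "y \<in> ball x e"
    then have y': "y \<in> ball x r" "\<psi> y \<in> ball (\<psi> x) q" using e in_ball by auto
    then have lin: "linear (\<psi>' y)" "linear (F' (\<psi> y))" using \<psi> F by (auto simp: C11_bound_def)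
    show "linear (\<lambda>h. F' (\<psi> y) (\<psi>' y h))" using linear_compose[OF lin] by (simp add: o_def)
    have nF: "norm (F' (\<psi> y) h) \<le> D * norm h" for h using F y' by (auto simp: C11_bound_def)
    have n\<psi>: "norm (\<psi>' y h) \<le> C * norm h" for h using \<psi> y' by (auto simp: C11_bound_def)
    show "norm (F' (\<psi> y) (\<psi>' y h)) \<le> (D * C + D * K\<^sup>2) * norm h" for h
    proof -
      have "norm (F' (\<psi> y) (\<psi>' y h)) \<le> D * (C * norm h)"
        using order_trans[OF nF mult_left_mono[OF n\<psi> q(2)]] .
      moreover have "0 \<le> D * K\<^sup>2 * norm h" using q by simp
      ultimately show ?thesis by (simp add: algebra_simps)
    qed
    show "norm (F (\<psi> z) - F (\<psi> y) - F' (\<psi> y) (\<psi>' y (z - y))) \<le> (D * C + D * K\<^sup>2) * (norm (z - y))\<^sup>2"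
      if z: "z \<in> ball x e" for z
    proof -
      have z': "z \<in> ball x r" "\<psi> z \<in> ball (\<psi> x) q" using e in_ball z by auto
      have "F (\<psi> z) - F (\<psi> y) - F' (\<psi> y) (\<psi>' y (z - y))
        = (F (\<psi> z) - F (\<psi> y) - F' (\<psi> y) (\<psi> z - \<psi> y)) + F' (\<psi> y) (\<psi> z - \<psi> y - \<psi>' y (z - y))"
        using lin(2) by (simp add: linear_diff)
      moreover have "norm (F (\<psi> z) - F (\<psi> y) - F' (\<psi> y) (\<psi> z - \<psi> y)) \<le> D * K\<^sup>2 * (norm (z - y))\<^sup>2"
      proof -
        have "norm (F (\<psi> z) - F (\<psi> y) - F' (\<psi> y) (\<psi> z - \<psi> y)) \<le> D * (norm (\<psi> z - \<psi> y))\<^sup>2"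
          using F y' z' by (auto simp: C11_bound_def)
        also have "\<dots> \<le> D * (K * norm (z - y))\<^sup>2"
          using lip[OF y'(1) z'(1)] q(2) by (intro mult_left_mono power_mono) auto
        finally show ?thesis by (simp add: power_mult_distrib)
      qed
      moreover have "norm (F' (\<psi> y) (\<psi> z - \<psi> y - \<psi>' y (z - y))) \<le> D * C * (norm (z - y))\<^sup>2"
      proof -
        have "norm (\<psi> z - \<psi> y - \<psi>' y (z - y)) \<le> C * (norm (z - y))\<^sup>2"
          using \<psi> y' z' by (auto simp: C11_bound_def)
        from order_trans[OF nF mult_left_mono[OF this q(2)]] show ?thesis by (simp add: mult.assoc)
      qed
      ultimately show ?thesis
        unfolding distrib_right by (metis add.commute norm_triangle_mono)
    qed
  qed
  then show ?thesis unfolding C11_at_def using e(1) q r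
    by (metis add_nonneg_nonneg mult_nonneg_nonneg zero_le_power2)
qed

text \<open>Two derivatives suffice: by compactness the second is bounded, by convexity the first is
  then Lipschitz, and the mean value inequality along segments gives the quadratic
  remainder.\<close>

lemma smooth_on_C11_bound:
  fixes f :: "'a::euclidean_space \<Rightarrow> 'b::real_normed_vector"
  assumes f: "smooth_on S f" and S: "open S" and K: "compact K" "convex K" "K \<subseteq> S"
  shows "\<exists>C\<ge>0. \<exists>f'. C11_bound C K f f'"
proof -
  define f' where "f' x = frechet_derivative f (at x)" for x
  define f'' where "f'' b x = frechet_derivative (\<lambda>x. f' x b) (at x)" for b x
  have ck: "Ck_on (Suc (Suc 0)) S f" using f by (simp add: smooth_on_def del: Ck_on.simps)
  have df: "(f has_derivative f' x) (at x)" if "x \<in> S" for x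
    unfolding f'_def frechet_derivative_works[symmetric]
    using ck that by (simp add: differentiable_on_eq_differentiable_at[OF S])
  have df': "((\<lambda>x. f' x b) has_derivative f'' b x) (at x)" if "x \<in> S" for x b
    unfolding f'_def f''_def frechet_derivative_works[symmetric]
    using ck that by (simp add: differentiable_on_eq_differentiable_at[OF S])
  have cont: "continuous_on S (\<lambda>x. f' x b)" "continuous_on S (\<lambda>x. f'' b x c)" for b c
    using ck unfolding f'_def f''_def by auto
  have lin: "linear (f' x)" "linear (f'' b x)" if "x \<in> S" for x b
    using df[OF that] df'[OF that, of b] has_derivative_bounded_linear bounded_linear.linear by blast+
  \<comment> \<open>One continuous function dominating all first and second partial derivatives, so
    that compactness yields a single bound M.\<close>
  define A where "A x = (\<Sum>b\<in>(Basis::'a set). norm (f' x b) + (\<Sum>c\<in>(Basis::'a set). norm (f'' b x c)))" for x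
  have "continuous_on (K) A"
    unfolding A_def using cont K(3)
    by (intro continuous_on_sum continuous_on_add continuous_on_norm) (auto intro: continuous_on_subset)
  then have "compact (A ` K)" using K(1) by (intro compact_continuous_image)
  then obtain M where M0: "M > 0" and M: "\<And>x. x \<in> K \<Longrightarrow> \<bar>A x\<bar> \<le> M"
    using compact_imp_bounded[OF \<open>compact (A ` K)\<close>] unfolding bounded_pos by auto
  have M1: "norm (f' x b) \<le> M" and M2: "c \<in> Basis \<Longrightarrow> norm (f'' b x c) \<le> M"
    if x: "x \<in> K" and b: "b \<in> Basis" for x b c
  proof -
    have "norm (f' x b) + (\<Sum>c\<in>(Basis::'a set). norm (f'' b x c)) \<le> A x"
      unfolding A_def using b by (intro member_le_sum) (auto intro!: add_nonneg_nonneg sum_nonneg)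
    moreover have "c \<in> Basis \<Longrightarrow> norm (f'' b x c) \<le> (\<Sum>c\<in>(Basis::'a set). norm (f'' b x c))"
      by (intro member_le_sum) auto
    moreover have "0 \<le> (\<Sum>c\<in>(Basis::'a set). norm (f'' b x c))" by (intro sum_nonneg) auto
    ultimately show "norm (f' x b) \<le> M" "c \<in> Basis \<Longrightarrow> norm (f'' b x c) \<le> M"
      using M[OF x] norm_ge_zero[of "f' x b"] by linarith+
  qed
  define n where "n = real DIM('a)"
  have n: "n \<ge> 0" by (simp add: n_def)
  have f'b: "norm (f' x h) \<le> n * M * norm h" if "x \<in> K" for x h
    unfolding n_def by (rule linear_norm_le_Basis) (use that K(3) M1 lin in auto)
  have lipb: "norm (f' y b - f' x b) \<le> n * M * norm (y - x)"
    if "x \<in> K" "y \<in> K" "b \<in> Basis" for x y b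
  proof (rule differentiable_bound[where S = "K" and f' = "\<lambda>x. f'' b x"])
    fix z assume z: "z \<in> K"
    then show "((\<lambda>x. f' x b) has_derivative f'' b z) (at z within K)"
      using df' K has_derivative_at_withinI by blast
    have "norm (f'' b z h) \<le> n * M * norm h" for h
      unfolding n_def by (rule linear_norm_le_Basis) (use z K M2 that lin in auto)
    then show "onorm (f'' b z) \<le> n * M" by (rule onorm_le)
  qed (use that K in auto)
  \<comment> \<open>Each passage from basis vectors to arbitrary ones costs a factor n: once in
    \<open>lipb\<close> for the second derivative, once here for h.\<close>
  have lip: "norm (f' y h - f' x h) \<le> n * (n * M * norm (y - x)) * norm h"
    if "x \<in> K" "y \<in> K" for x y h
  proof -
    have "linear (\<lambda>h. f' y h - f' x h)" using lin that K by (intro linear_compose_sub) auto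
    then show ?thesis unfolding n_def
      by (rule linear_norm_le_Basis) (use lipb that in \<open>auto simp: n_def\<close>)
  qed
  have "C11_bound (n * M + n * (n * M)) (K) f f'"
    unfolding C11_bound_def
  proof (intro ballI conjI allI)
    fix x assume x: "x \<in> K"
    show "linear (f' x)" using lin x K by auto
    show "norm (f' x h) \<le> (n * M + n * (n * M)) * norm h" for h
    proof -
      have "0 \<le> n * (n * M) * norm h" using n M0 by simp
      then show ?thesis using f'b[OF x, of h] by (simp add: algebra_simps)
    qed
    fix y assume y: "y \<in> K"
    have seg: "x + t *\<^sub>R (y - x) \<in> K" if "t \<in> {0..1}" for t
    proof -
      have "x + t *\<^sub>R (y - x) = (1 - t) *\<^sub>R x + t *\<^sub>R y" by (simp add: algebra_simps)
      then show ?thesis using K(2) x y that by (simp add: convex_alt)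
    qed
    have "norm (f y - f x - f' x (y - x)) \<le> norm (y - x) * (n * (n * M * norm (y - x)))"
    proof (rule differentiable_bound_linearization[where S = "(\<lambda>t. x + t *\<^sub>R (y - x)) ` {0..1}"])
      show "(f has_derivative f' z) (at z within (\<lambda>t. x + t *\<^sub>R (y - x)) ` {0..1})"
        if "z \<in> (\<lambda>t. x + t *\<^sub>R (y - x)) ` {0..1}" for z
        using that df seg K has_derivative_at_withinI by blast
      show "onorm (f' z - f' x) \<le> n * (n * M * norm (y - x))"
        if z: "z \<in> (\<lambda>t. x + t *\<^sub>R (y - x)) ` {0..1}" for z
      proof (rule onorm_le)
        obtain t where t: "t \<in> {0..1}" "z = x + t *\<^sub>R (y - x)" using z by blast
        fix h :: 'a
        have "norm (x + t *\<^sub>R (y - x) - x) \<le> norm (y - x)"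
          using t by (auto intro: mult_left_le_one_le)
        then have "n * (n * M * norm (x + t *\<^sub>R (y - x) - x)) * norm h \<le> n * (n * M * norm (y - x)) * norm h"
          using n M0 by (intro mult_right_mono mult_left_mono) auto
        then show "norm ((f' z - f' x) h) \<le> n * (n * M * norm (y - x)) * norm h"
          using lip[OF x seg[OF t(1)], of h] t(2) by simp
      qed
    qed (auto intro: image_eqI[of _ _ 0])
    also have "\<dots> = n * (n * M) * (norm (y - x))\<^sup>2" by (simp add: power2_eq_square algebra_simps)
    also have "\<dots> \<le> (n * M + n * (n * M)) * (norm (y - x))\<^sup>2"
      using n M0 by (intro mult_right_mono) auto
    finally show "norm (f y - f x - f' x (y - x)) \<le> (n * M + n * (n * M)) * (norm (y - x))\<^sup>2" .
  qed
  then show ?thesis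
    using n M0 by (intro exI[of _ "n * M + n * (n * M)"] conjI exI[of _ f']) auto
qed

lemma smooth_on_C11_at:
  fixes f :: "'a::euclidean_space \<Rightarrow> 'b::real_normed_vector"
  assumes f: "smooth_on S f" and S: "open S" and x: "x \<in> S"
  shows "C11_at f x"
proof -
  obtain r where r: "r > 0" "cball x r \<subseteq> S" using S x open_contains_cball by blast
  then obtain C f' where "C \<ge> 0" "C11_bound C (cball x r) f f'"
    using smooth_on_C11_bound[OF f S, of "cball x r"] by auto
  then show ?thesis
    unfolding C11_at_def using C11_bound_mono[of C "cball x r" f f' C "ball x r"] r(1) ball_subset_cball by blast
qed

text \<open>The difference of the derivatives on k is a combination of three remainders: x to y + k,
  y to y + k, and x to y. With |k| = |y - x| they contribute 4 C, C and C. The radius 3 r keeps y +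
  k inside, since |k| < 2 r.\<close>

lemma C11_bound_lipschitz:
  fixes f :: "'a::real_normed_vector \<Rightarrow> 'b::real_normed_vector"
  assumes f: "C11_bound C (ball x0 (3 * r)) f f'" and x: "x \<in> ball x0 r" and y: "y \<in> ball x0 r" and C: "C \<ge> 0"
  shows "norm (f' y h - f' x h) \<le> 6 * C * norm (y - x) * norm h"
proof (cases "h = 0 \<or> x = y")
  case True
  have "x \<in> ball x0 (3 * r)" "y \<in> ball x0 (3 * r)"
    using x y zero_le_dist[of x0 x] unfolding mem_ball by linarith+
  then have "linear (f' x)" "linear (f' y)"
    using f by (auto simp: C11_bound_def)
  then show ?thesis using True C by (auto simp: linear_0)
next
  case False
  define d where "d = y - x"
  \<comment> \<open>Rescaling h to the length of d makes all remainders comparable to |d|^2;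
    linearity undoes the scaling at the end.\<close>
  define k where "k = (norm d / norm h) *\<^sub>R h"
  have nd: "norm d > 0" "norm h > 0" using False by (auto simp: d_def)
  have nk: "norm k = norm d" using nd by (simp add: k_def)
  have r: "r > 0" using x by (metis dist_not_less_zero linorder_not_le mem_ball order_less_le_trans)
  have "norm d < 2 * r"
    using x y dist_triangle3[of y x x0] by (simp add: d_def dist_norm)
  then have "dist x0 (y + k) < 3 * r"
    using y nk norm_triangle_ineq[of "x0 - y" "- k"] by (simp add: dist_norm algebra_simps)
  then have mem: "x \<in> ball x0 (3 * r)" "y \<in> ball x0 (3 * r)" "y + k \<in> ball x0 (3 * r)"
    using x y r by auto
  have lx: "linear (f' x)" "linear (f' y)" using f mem by (auto simp: C11_bound_def)
  have 1: "norm (f (y + k) - f y - f' y k) \<le> C * (norm d)\<^sup>2"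
    using f mem nk unfolding C11_bound_def by (metis add_diff_cancel_left')
  have "norm (f (y + k) - f x - f' x (y + k - x)) \<le> C * (norm (y + k - x))\<^sup>2"
    using f mem unfolding C11_bound_def by blast
  also have "y + k - x = d + k" by (simp add: d_def)
  also have "C * (norm (d + k))\<^sup>2 \<le> C * (2 * norm d)\<^sup>2"
    using C nk norm_triangle_ineq[of d k] by (intro mult_left_mono power_mono) auto
  finally have 2: "norm (f (y + k) - f x - f' x (d + k)) \<le> 4 * C * (norm d)\<^sup>2" by (simp add: power_mult_distrib)
  have 3: "norm (f y - f x - f' x d) \<le> C * (norm d)\<^sup>2"
    using f mem unfolding C11_bound_def d_def by blast
  have "f' y k - f' x k = (f (y + k) - f x - f' x (d + k)) - (f (y + k) - f y - f' y k) - (f y - f x - f' x d)"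
    using lx by (simp add: linear_add)
  moreover have "norm (a - b - c) \<le> norm a + norm b + norm c" for a b c :: 'b
    using norm_triangle_ineq4[of "a - b" c] norm_triangle_ineq4[of a b] by linarith
  ultimately have "norm (f' y k - f' x k)
    \<le> norm (f (y + k) - f x - f' x (d + k)) + norm (f (y + k) - f y - f' y k) + norm (f y - f x - f' x d)"
    by metis
  then have "norm (f' y k - f' x k) \<le> 6 * C * (norm d)\<^sup>2"
    using 1 2 3 by linarith
  moreover have "f' y k - f' x k = (norm d / norm h) *\<^sub>R (f' y h - f' x h)"
    using lx by (simp add: k_def linear_scale scaleR_diff_right)
  ultimately have "norm d / norm h * norm (f' y h - f' x h) \<le> 6 * C * (norm d)\<^sup>2"
    by simp
  then have "norm (f' y h - f' x h) \<le> 6 * C * norm d * norm h"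
    using nd by (simp add: field_simps power2_eq_square)
  then show ?thesis by (simp add: d_def)
qed

lemma C11_bound_has_derivative:
  assumes f: "C11_bound C V f f'" and V: "open V" and x: "x \<in> V" and C: "C \<ge> 0"
  shows "(f has_derivative f' x) (at x)"
  unfolding has_derivative_at_within
proof (intro conjI)
  show "bounded_linear (f' x)"
    using f x by (auto simp: C11_bound_def mult.commute intro!: bounded_linear_intro[where K = C]
        dest: linear_add linear_scale)
  have "((\<lambda>y. C * norm (y - x)) \<longlongrightarrow> C * norm (x - x)) (at x)"
    by (intro tendsto_intros)
  then have lim: "((\<lambda>y. C * norm (y - x)) \<longlongrightarrow> 0) (at x)" by simp
  show "((\<lambda>y. (f y - f x - f' x (y - x)) /\<^sub>R norm (y - x)) \<longlongrightarrow> 0) (at x)"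
  proof (rule Lim_null_comparison[OF _ lim])
    show "\<forall>\<^sub>F y in at x. norm ((f y - f x - f' x (y - x)) /\<^sub>R norm (y - x)) \<le> C * norm (y - x)"
      using eventually_at_in_open'[OF V x]
    proof eventually_elim
      case (elim y)
      then have "norm (f y - f x - f' x (y - x)) \<le> C * norm (y - x) * norm (y - x)"
        using f x by (auto simp: C11_bound_def power2_eq_square mult.assoc)
      then show ?case
        by (cases "y = x") (auto simp: divide_inverse_commute[symmetric] divide_le_eq mult.commute)
    qed
  qed
qed

lemma C11_at_gradient:
  fixes f :: "'a::euclidean_space \<Rightarrow> real"
  assumes "C11_at f x0"
  shows "\<exists>e>0. \<exists>grad L. (\<forall>z\<in>ball x0 e. GDERIV f z :> grad z) \<and> L-lipschitz_on (ball x0 e) grad"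
proof -
  obtain r C f' where r: "r > 0" "C \<ge> 0" and f: "C11_bound C (ball x0 r) f f'"
    using assms by (auto simp: C11_at_def)
  define e where "e = r / 3"
  have e: "e > 0" and f: "C11_bound C (ball x0 (3 * e)) f f'" using r f by (auto simp: e_def)
  \<comment> \<open>The Riesz representative of the linear form \<open>f' z\<close>.\<close>
  define grad where "grad z = adjoint (f' z) 1" for z
  have lin: "linear (f' z)" if "z \<in> ball x0 (3 * e)" for z using f that by (auto simp: C11_bound_def)
  have inner: "h \<bullet> grad z = f' z h" if "z \<in> ball x0 (3 * e)" for h z
    using adjoint_works[OF lin[OF that], of h 1] by (simp add: grad_def)
  have "GDERIV f z :> grad z" if "z \<in> ball x0 e" for z
  proof -
    have z: "z \<in> ball x0 (3 * e)" using that e by auto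
    have "(\<lambda>h. h \<bullet> grad z) = f' z" using inner[OF z] by auto
    then show ?thesis
      unfolding gderiv_def using C11_bound_has_derivative[OF f _ z r(2)] by simp
  qed
  moreover have "(6 * C)-lipschitz_on (ball x0 e) grad"
  proof (rule lipschitz_onI)
    fix x y assume xy: "x \<in> ball x0 e" "y \<in> ball x0 e"
    then have xy': "x \<in> ball x0 (3 * e)" "y \<in> ball x0 (3 * e)" using e by auto
    \<comment> \<open>Testing the difference of the two forms on the difference of their gradients
      turns the operator bound into a bound on vectors.\<close>
    define h where "h = grad x - grad y"
    have "norm h * norm h = h \<bullet> h" by (simp add: dot_square_norm power2_eq_square)
    also have "\<dots> = f' x h - f' y h"
      using inner[OF xy'(1), of h] inner[OF xy'(2), of h] by (simp add: h_def inner_diff_right)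
    also have "\<dots> \<le> 6 * C * norm (x - y) * norm h"
      using C11_bound_lipschitz[OF f xy(2,1) r(2), of h] by simp
    finally have "norm h \<le> 6 * C * norm (x - y)"
      by (cases "h = 0") (use r in auto)
    then show "dist (grad x) (grad y) \<le> 6 * C * dist x y" by (simp add: h_def dist_norm)
  qed (use r in auto)
  ultimately show ?thesis using e by blast
qed

lemma R_op_C11_at:
  fixes w :: "real^'n \<Rightarrow> real"
  assumes w: "\<forall>y. \<bar>w y\<bar> \<le> M" and s: "s > 0"
  shows "C11_at (R_op s w) x0"
proof -
  obtain p where p: "\<And>x y. \<bar>R_op s w y - R_op s w x - p x \<bullet> (y - x)\<bar> \<le> 3 / s * (norm (y - x))\<^sup>2"
    using R_op_gradient[OF w s] by blast
  \<comment> \<open>The expansion along the unit vector in the direction of p x: values of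
    \<open>R_op\<close> differ by at most 2 M, and the remainder is at most 3/s.\<close>
  have pb: "norm (p x) \<le> 2 * M + 3 / s" for x
  proof (cases "p x = 0")
    case True
    have "M \<ge> 0" using w[rule_format, of x] by linarith
    then show ?thesis using True s by simp
  next
    case False
    define h where "h = p x /\<^sub>R norm (p x)"
    have "norm h = 1" "p x \<bullet> h = norm (p x)"
      using False by (simp_all add: h_def dot_square_norm power2_eq_square)
    then show ?thesis
      using p[where x = x and y = "x + h"] R_op_abs_le[OF w s, of x] R_op_abs_le[OF w s, of "x + h"] by simp
  qed
  have "C11_bound (2 * M + 3 / s) (ball x0 1) (R_op s w) (\<lambda>x h. p x \<bullet> h)"
    unfolding C11_bound_def
  proof (intro ballI conjI allI)
    fix x y h :: "real^'n"
    show "linear ((\<bullet>) (p x))" by (simp add: bounded_linear.linear bounded_linear_inner_right)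
    have "\<bar>p x \<bullet> h\<bar> \<le> norm (p x) * norm h" by (rule Cauchy_Schwarz_ineq2)
    also have "\<dots> \<le> (2 * M + 3 / s) * norm h" using pb by (intro mult_right_mono) auto
    finally show "norm (p x \<bullet> h) \<le> (2 * M + 3 / s) * norm h" by simp
    have "M \<ge> 0" using w[rule_format, of x] by linarith
    then have "3 / s * (norm (y - x))\<^sup>2 \<le> (2 * M + 3 / s) * (norm (y - x))\<^sup>2"
      by (intro mult_right_mono) auto
    then show "norm (R_op s w y - R_op s w x - p x \<bullet> (y - x)) \<le> (2 * M + 3 / s) * (norm (y - x))\<^sup>2"
      using p[where x = x and y = y] by simp
  qed
  moreover have "2 * M + 3 / s \<ge> 0" using pb[of x0] norm_ge_zero order_trans by blast
  ultimately show ?thesis unfolding C11_at_def using zero_less_one by blast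
qed

section \<open>Semi-concavity after a smooth cutoff\<close>

lemma concave_quadratic_supergradient:
  fixes k :: "'a::euclidean_space \<Rightarrow> real"
  assumes k: "concave_on S (\<lambda>y. k y - (norm y)\<^sup>2 / b)" and S: "open S" "convex S" "x \<in> S"
  shows "\<exists>q. \<forall>y\<in>S. k y \<le> k x + q \<bullet> (y - x) + (norm (y - x))\<^sup>2 / b"
proof -
  obtain p where p: "\<And>y. y \<in> S \<Longrightarrow> k y - (norm y)\<^sup>2 / b \<le> k x - (norm x)\<^sup>2 / b + p \<bullet> (y - x)"
    using concave_supergradient[OF k S] by blast
  have "k y \<le> k x + (p + (2 / b) *\<^sub>R x) \<bullet> (y - x) + (norm (y - x))\<^sup>2 / b" if "y \<in> S" for y
  proof -
    have "(norm y)\<^sup>2 - (norm x)\<^sup>2 = 2 * (x \<bullet> (y - x)) + (norm (y - x))\<^sup>2"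
      unfolding power2_norm_eq_inner by (simp add: inner_diff_left inner_diff_right inner_commute)
    then have "(norm y)\<^sup>2 / b - (norm x)\<^sup>2 / b = (2 / b) * (x \<bullet> (y - x)) + (norm (y - x))\<^sup>2 / b"
      by (metis (no_types, opaque_lifting) add_divide_distrib diff_divide_distrib times_divide_eq_left)
    then show ?thesis using p[OF that] unfolding inner_add_left inner_scaleR_left by linarith
  qed
  then show ?thesis by blast
qed

lemma bounded_zero_outside:
  fixes w :: "'a::heine_borel \<Rightarrow> real"
  assumes "continuous_on (cball a r) w" and "\<And>y. y \<notin> cball a r \<Longrightarrow> w y = 0"
  obtains M where "M \<ge> 0" "\<forall>y. \<bar>w y\<bar> \<le> M"
proof -
  have "compact (w ` cball a r)" using assms(1) by (intro compact_continuous_image) auto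
  then obtain M where M: "\<And>x. x \<in> cball a r \<Longrightarrow> \<bar>w x\<bar> \<le> M"
    by (meson bounded_real compact_imp_bounded imageI)
  have "\<bar>w y\<bar> \<le> \<bar>M\<bar>" for y using M[of y] assms(2)[of y] by (cases "y \<in> cball a r") auto
  then show ?thesis using that[of "\<bar>M\<bar>"] by simp
qed

text \<open>The margin q - r is the point: if two points are closer than it and one leaves the
  larger ball, both are outside the smaller one, where w vanishes.\<close>

lemma uniformly_continuous_zero_outside:
  fixes w :: "'a::euclidean_space \<Rightarrow> real"
  assumes w: "continuous_on (cball a q) w" and rq: "r < q" and z: "\<And>y. y \<notin> cball a r \<Longrightarrow> w y = 0" and \<epsilon>: "\<epsilon> > 0"
  obtains \<delta> where "\<delta> > 0" "\<And>x y. norm (y - x) < \<delta> \<Longrightarrow> \<bar>w y - w x\<bar> \<le> \<epsilon>"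
proof -
  have "uniformly_continuous_on (cball a q) w" using w by (intro compact_uniformly_continuous) auto
  then obtain d where d: "d > 0" "\<And>x y. x \<in> cball a q \<Longrightarrow> y \<in> cball a q \<Longrightarrow> dist y x < d \<Longrightarrow> dist (w y) (w x) < \<epsilon>"
    using \<epsilon> unfolding uniformly_continuous_on_def by metis
  show ?thesis
  proof (rule that[of "min d (q - r)"])
    fix x y :: 'a assume xy: "norm (y - x) < min d (q - r)"
    show "\<bar>w y - w x\<bar> \<le> \<epsilon>"
    proof (cases "x \<in> cball a q \<and> y \<in> cball a q")
      case True
      then show ?thesis using d(2)[of x y] xy by (simp add: dist_norm)
    next
      case False
      then have "dist a x > r" "dist a y > r"
        using xy rq dist_triangle[of a x y] dist_triangle[of a y x] by (auto simp: dist_norm norm_minus_commute)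
      then show ?thesis using z \<epsilon> by simp
    qed
  qed (use d rq in auto)
qed

text \<open>Near the support, the supergradient inequality for k is multiplied by
  \<open>\<gamma>\<close> y >= 0 and \<open>\<gamma>\<close> is expanded to second order at x. Pairs
  x, y at distance at least \<open>\<eta>\<close> need only boundedness, absorbed by a large
  multiple of |y - x|^2.\<close>

lemma semiconcave_cutoff:
  fixes \<gamma> k :: "'a::euclidean_space \<Rightarrow> real"
  assumes \<gamma>: "smooth_on (ball 0 1) \<gamma>" "\<And>y. y \<in> ball 0 1 \<Longrightarrow> \<gamma> y \<ge> 0"
    and r: "0 \<le> r" "r < 1" and supp: "\<And>y. y \<in> ball 0 1 \<Longrightarrow> norm y > r \<Longrightarrow> \<gamma> y = 0"
    and k: "continuous_on (ball 0 1) k" "concave_on (ball 0 1) (\<lambda>y. k y - (norm y)\<^sup>2 / b)" and b: "b > 0"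
  shows "\<exists>C>0. semiconcave_with C (\<lambda>y. if y \<in> ball 0 1 then \<gamma> y * k y else 0)"
proof -
  define w where "w y = (if y \<in> ball 0 1 then \<gamma> y * k y else 0)" for y
  \<comment> \<open>A margin for nested balls: support in radius r, base points x up to
    \<open>r + \<eta>\<close>, nearby y up to \<open>r + 2 * \<eta>\<close>, bounds up to
    \<open>r + 3 * \<eta>\<close>, still below 1.\<close>
  define \<eta> where "\<eta> = (1 - r) / 4"
  have \<eta>: "\<eta> > 0" "r + 3 * \<eta> < 1" using r by (auto simp: \<eta>_def field_simps)
  have sub: "cball 0 (r + 2 * \<eta>) \<subseteq> (ball 0 1 :: 'a set)" "cball 0 (r + 3 * \<eta>) \<subseteq> (ball 0 1 :: 'a set)"
    using \<eta> by auto
  obtain D \<gamma>' where D: "D \<ge> 0" and \<gamma>': "C11_bound D (cball 0 (r + 2 * \<eta>)) \<gamma> \<gamma>'"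
    using smooth_on_C11_bound[OF \<gamma>(1), of "cball 0 (r + 2 * \<eta>)"] sub by auto
  have c\<gamma>: "continuous_on (ball 0 1) \<gamma>"
    using \<gamma>(1) unfolding smooth_on_def by (metis Ck_on.simps(1))
  define k0 where "k0 y = (if y \<in> cball 0 (r + 3 * \<eta>) then k y else 0)" for y
  define \<gamma>0 where "\<gamma>0 y = (if y \<in> cball 0 (r + 3 * \<eta>) then \<gamma> y else 0)" for y
  have "continuous_on (cball 0 (r + 3 * \<eta>)) k0"
    using continuous_on_subset[OF k(1) sub(2)] by (rule continuous_on_cong[THEN iffD1, rotated -1]) (auto simp: k0_def)
  then obtain M where M: "M \<ge> 0" "\<forall>y. \<bar>k0 y\<bar> \<le> M"
    by (rule bounded_zero_outside) (auto simp: k0_def)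
  have "continuous_on (cball 0 (r + 3 * \<eta>)) \<gamma>0"
    using continuous_on_subset[OF c\<gamma> sub(2)] by (rule continuous_on_cong[THEN iffD1, rotated -1]) (auto simp: \<gamma>0_def)
  then obtain N where N: "N \<ge> 0" "\<forall>y. \<bar>\<gamma>0 y\<bar> \<le> N"
    by (rule bounded_zero_outside) (auto simp: \<gamma>0_def)
  have kM: "\<bar>k y\<bar> \<le> M" and \<gamma>N: "\<bar>\<gamma> y\<bar> \<le> N" if "norm y \<le> r + 3 * \<eta>" for y
    using M(2)[rule_format, of y] N(2)[rule_format, of y] that by (auto simp: k0_def \<gamma>0_def)
  have wz: "w y = 0" if "norm y > r" for y
    using supp[of y] that by (auto simp: w_def)
  have wb: "\<bar>w y\<bar> \<le> N * M" for y
  proof (cases "norm y > r")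
    case False
    then have "\<bar>\<gamma> y\<bar> * \<bar>k y\<bar> \<le> N * M" using kM[of y] \<gamma>N[of y] \<eta> N(1) by (intro mult_mono) auto
    then show ?thesis using N(1) M(1) by (simp add: w_def abs_mult)
  qed (use wz N(1) M(1) in auto)
  \<comment> \<open>Bounds the supergradient q of k: a step of length \<open>\<eta>\<close> against
    q lowers the upper bound by \<open>\<eta> * norm q\<close>, while |k| <= M.\<close>
  define Q where "Q = (2 * M + \<eta>\<^sup>2 / b) / \<eta>"
  have Q0: "Q \<ge> 0" using M(1) \<eta> b by (simp add: Q_def)
  \<comment> \<open>The first three terms collect the second-order errors for nearby y, the next two
    handle distant y, and the 1 ensures positivity.\<close>
  define C where "C = M * D + 3 * D * Q + N / b + N * M / \<eta>\<^sup>2 + (M * D + N * Q) / \<eta> + 1"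
  have Cparts: "M * D \<ge> 0" "3 * D * Q \<ge> 0" "N / b \<ge> 0" "N * M / \<eta>\<^sup>2 \<ge> 0" "(M * D + N * Q) / \<eta> \<ge> 0"
    using M(1) D Q0 N(1) b \<eta>(1) by auto
  have grad: "\<exists>p. \<forall>y. w y \<le> w x + p \<bullet> (y - x) + C * (norm (y - x))\<^sup>2" for x
  proof (cases "norm x \<le> r + \<eta>")
    case False
    have "w y \<le> w x + 0 \<bullet> (y - x) + C * (norm (y - x))\<^sup>2" for y
    proof (cases "norm y > r")
      case True
      have "C \<ge> 0" using Cparts by (simp add: C_def)
      then show ?thesis using wz[OF True] wz[of x] False \<eta> by simp
    next
      case nF: False
      then have "\<eta> \<le> norm (y - x)" using False norm_triangle_ineq2[of x y] by (simp add: norm_minus_commute)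
      then have "\<eta>\<^sup>2 \<le> (norm (y - x))\<^sup>2" using \<eta> by (intro power_mono) auto
      then have "N * M / \<eta>\<^sup>2 * \<eta>\<^sup>2 \<le> N * M / \<eta>\<^sup>2 * (norm (y - x))\<^sup>2" using Cparts by (intro mult_left_mono)
      also have "\<dots> \<le> C * (norm (y - x))\<^sup>2" using Cparts by (intro mult_right_mono) (auto simp: C_def)
      finally have "N * M \<le> C * (norm (y - x))\<^sup>2" using \<eta> by simp
      then show ?thesis using wb[of y] wz[of x] False \<eta> by simp
    qed
    then show ?thesis by blast
  next
    case x: True
    then have xB: "x \<in> ball 0 1" and xc: "x \<in> cball 0 (r + 2 * \<eta>)" using \<eta> by auto
    obtain q where q: "\<And>y. y \<in> ball 0 1 \<Longrightarrow> k y \<le> k x + q \<bullet> (y - x) + (norm (y - x))\<^sup>2 / b"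
      using concave_quadratic_supergradient[OF k(2) open_ball convex_ball xB] by blast
    have qQ: "norm q \<le> Q"
    proof (cases "q = 0")
      case False
      define h where "h = - (\<eta> / norm q) *\<^sub>R q"
      have h: "norm h = \<eta>" "q \<bullet> h = - (\<eta> * norm q)"
        using False \<eta> by (simp_all add: h_def dot_square_norm power2_eq_square)
      have "norm (x + h) \<le> r + 2 * \<eta>" using norm_triangle_ineq[of x h] x h by simp
      then have "- M \<le> k (x + h)" "k (x + h) \<le> k x - \<eta> * norm q + \<eta>\<^sup>2 / b" "k x \<le> M"
        using kM[of "x + h"] kM[of x] q[of "x + h"] h x \<eta> by auto
      then have "norm q * \<eta> \<le> 2 * M + \<eta>\<^sup>2 / b" by (simp add: mult.commute)
      then show ?thesis unfolding Q_def using \<eta>(1) by (simp only: pos_le_divide_eq)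
    qed (use Q0 in simp)
    \<comment> \<open>The product rule, with the supergradient q in place of a derivative of
      k.\<close>
    define P where "P h = k x * \<gamma>' x h + \<gamma> x * (q \<bullet> h)" for h
    have lin: "linear (\<gamma>' x)" and n\<gamma>': "\<bar>\<gamma>' x h\<bar> \<le> D * norm h" for h
      using \<gamma>' xc by (auto simp: C11_bound_def)
    have "linear P"
      using linear_add[OF lin] linear_scale[OF lin]
      by (intro linearI) (auto simp: P_def inner_add_right algebra_simps)
    then have P: "adjoint P 1 \<bullet> h = P h" for h
      using adjoint_works[of P h 1] by (simp add: inner_commute)
    have Pb: "\<bar>P h\<bar> \<le> (M * D + N * Q) * norm h" for h
    proof -
      have "\<bar>k x * \<gamma>' x h\<bar> \<le> M * (D * norm h)"
        unfolding abs_mult using kM[of x] x n\<gamma>'[of h] \<eta> by (intro mult_mono) auto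
      moreover have "\<bar>q \<bullet> h\<bar> \<le> Q * norm h"
        using Cauchy_Schwarz_ineq2[of q h] mult_right_mono[OF qQ, of "norm h"] by simp
      then have "\<bar>\<gamma> x * (q \<bullet> h)\<bar> \<le> N * (Q * norm h)"
        unfolding abs_mult using \<gamma>N[of x] x \<eta> N(1) by (intro mult_mono) auto
      ultimately show ?thesis unfolding P_def by (simp add: algebra_simps)
    qed
    have "w y \<le> w x + adjoint P 1 \<bullet> (y - x) + C * (norm (y - x))\<^sup>2" for y
      unfolding P
    proof (cases "norm y \<le> r + 2 * \<eta>")
      case True
      define d where "d = y - x"
      define e where "e = \<gamma> y - \<gamma> x - \<gamma>' x d"
      have yB: "y \<in> ball 0 1" and yc: "y \<in> cball 0 (r + 2 * \<eta>)" using True \<eta> by auto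
      have e: "\<bar>e\<bar> \<le> D * (norm d)\<^sup>2"
        using \<gamma>' xc yc unfolding C11_bound_def e_def d_def by auto
      have "norm d \<le> 2" using norm_triangle_ineq4[of y x] xB yB by (simp add: d_def)
      then have d2: "(norm d)\<^sup>2 \<le> 2 * norm d" unfolding power2_eq_square by (intro mult_right_mono) auto
      have "D * (norm d)\<^sup>2 \<le> D * (2 * norm d)" using d2 D by (rule mult_left_mono)
      \<comment> \<open>D from the derivative and 2 D from the remainder, as |d| <= 2.\<close>
      then have d\<gamma>: "\<bar>\<gamma> y - \<gamma> x\<bar> \<le> 3 * D * norm d"
        using e n\<gamma>'[of d] unfolding e_def by linarith
      have "\<gamma> y * k y \<le> \<gamma> y * (k x + q \<bullet> d + (norm d)\<^sup>2 / b)"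
        using q[OF yB] \<gamma>(2)[OF yB] unfolding d_def by (rule mult_left_mono)
      also have "\<dots> = \<gamma> x * k x + P d + (k x * e + (\<gamma> y - \<gamma> x) * (q \<bullet> d) + \<gamma> y * ((norm d)\<^sup>2 / b))"
        unfolding P_def e_def by (simp add: algebra_simps)
      also have "k x * e \<le> M * (D * (norm d)\<^sup>2)"
      proof -
        have "\<bar>k x * e\<bar> \<le> M * (D * (norm d)\<^sup>2)"
          unfolding abs_mult using kM[of x] x e \<eta> M(1) by (intro mult_mono) auto
        then show ?thesis by linarith
      qed
      also have "(\<gamma> y - \<gamma> x) * (q \<bullet> d) \<le> 3 * D * norm d * (Q * norm d)"
      proof -
        have "\<bar>q \<bullet> d\<bar> \<le> Q * norm d"
          using Cauchy_Schwarz_ineq2[of q d] mult_right_mono[OF qQ, of "norm d"] by simp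
        then have "\<bar>(\<gamma> y - \<gamma> x) * (q \<bullet> d)\<bar> \<le> 3 * D * norm d * (Q * norm d)"
          unfolding abs_mult using d\<gamma> D by (intro mult_mono) auto
        then show ?thesis by linarith
      qed
      also have "\<gamma> y * ((norm d)\<^sup>2 / b) \<le> N * ((norm d)\<^sup>2 / b)"
        using \<gamma>N[of y] True \<eta> b by (intro mult_right_mono) auto
      also have "M * (D * (norm d)\<^sup>2) + 3 * D * norm d * (Q * norm d) + N * ((norm d)\<^sup>2 / b)
        = (M * D + 3 * D * Q + N / b) * (norm d)\<^sup>2"
        by (simp add: power2_eq_square algebra_simps)
      also have "\<dots> \<le> C * (norm d)\<^sup>2"
        using Cparts by (intro mult_right_mono) (auto simp: C_def)
      finally show "w y \<le> w x + P (y - x) + C * (norm (y - x))\<^sup>2"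
        using xB yB by (simp add: w_def d_def)
    next
      case False
      \<comment> \<open>Here w y = 0, so C n^2 must outweigh w x and P (y - x); both are controlled
        since \<open>n \<ge> \<eta>\<close>.\<close>
      define n where "n = norm (y - x)"
      have n: "\<eta> \<le> n" using False x norm_triangle_ineq2[of y x] by (simp add: n_def)
      have "N * M \<le> N * M / \<eta>\<^sup>2 * n\<^sup>2"
      proof -
        have "\<eta>\<^sup>2 \<le> n\<^sup>2" using n \<eta> by (intro power_mono) auto
        then have "N * M / \<eta>\<^sup>2 * \<eta>\<^sup>2 \<le> N * M / \<eta>\<^sup>2 * n\<^sup>2" using Cparts by (intro mult_left_mono)
        then show ?thesis using \<eta> by simp
      qed
      moreover have "(M * D + N * Q) * n \<le> (M * D + N * Q) / \<eta> * n\<^sup>2"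
      proof -
        have "\<eta> * n \<le> n\<^sup>2" unfolding power2_eq_square using n \<eta> by (intro mult_right_mono) auto
        then have "(M * D + N * Q) / \<eta> * (\<eta> * n) \<le> (M * D + N * Q) / \<eta> * n\<^sup>2" using Cparts by (intro mult_left_mono)
        then show ?thesis using \<eta> by simp
      qed
      moreover have "(N * M / \<eta>\<^sup>2 + (M * D + N * Q) / \<eta>) * n\<^sup>2 \<le> C * n\<^sup>2"
        using Cparts by (intro mult_right_mono) (auto simp: C_def)
      ultimately have "N * M + (M * D + N * Q) * n \<le> C * n\<^sup>2" by (simp only: distrib_right)
      moreover have "w y = 0" using wz[of y] False \<eta> by simp
      ultimately show "w y \<le> w x + P (y - x) + C * (norm (y - x))\<^sup>2"
        using Pb[of "y - x"] wb[of x] unfolding n_def[symmetric] by linarith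
    qed
    then show ?thesis by blast
  qed
  have "C > 0" using Cparts by (simp add: C_def)
  moreover have "semiconcave_with C w" using grad unfolding semiconcave_with_def by blast
  ultimately show ?thesis unfolding w_def by blast
qed

section \<open>Charts and the partition of unity\<close>

definition chart_cutoff :: "('i \<Rightarrow> real^'n \<Rightarrow> 'm) \<Rightarrow> ('i \<Rightarrow> 'm \<Rightarrow> real) \<Rightarrow> ('m \<Rightarrow> real) \<Rightarrow> 'i \<Rightarrow> real^'n \<Rightarrow> real" where
  "chart_cutoff \<phi> g f i y = (if y \<in> Bn then g i (\<phi> i y) * f (\<phi> i y) else 0)"

lemma G_term_eq:
  "G_term \<phi> g a t f i x =
     (if x \<in> \<phi> i ` Bn then R_op (t * a i) (chart_cutoff \<phi> g f i) (inv_into Bn (\<phi> i) x) else 0)"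
  by (simp add: G_term_def chart_cutoff_def[abs_def])

lemma chart_cutoff_uminus: "chart_cutoff \<phi> g (\<lambda>x. - f x) i = (\<lambda>y. - chart_cutoff \<phi> g f i y)"
  by (auto simp: chart_cutoff_def)

lemma chart_cutoff_inv_into:
  "x \<in> \<phi> i ` Bn \<Longrightarrow> chart_cutoff \<phi> g f i (inv_into Bn (\<phi> i) x) = g i x * f x"
  unfolding chart_cutoff_def by (simp only: inv_into_into f_inv_into_f if_True)

lemma partition_support:
  assumes "smooth_partition_of_unity \<phi> g" and "x \<notin> \<phi> i ` Bn"
  shows "g i x = 0"
proof -
  have "closure {x. g i x \<noteq> 0} \<subseteq> \<phi> i ` Bn"
    using assms(1) by (simp add: smooth_partition_of_unity_def)
  then show ?thesis using assms(2) closure_subset[of "{x. g i x \<noteq> 0}"] by auto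
qed

text \<open>The support of \<open>g i\<close> is closed in a relatively compact set, hence compact;
  its preimage in the open ball is compact too, so the norm attains a maximum below 1 on it.\<close>

lemma chart_support_radius:
  fixes \<phi> :: "'i \<Rightarrow> real^'n \<Rightarrow> 'm::t2_space"
  assumes atlas: "smooth_atlas \<phi>" and pou: "smooth_partition_of_unity \<phi> g"
  obtains r where "0 \<le> r" "r < 1" "\<And>y. y \<in> Bn \<Longrightarrow> norm y > r \<Longrightarrow> g i (\<phi> i y) = 0"
proof -
  define K where "K = inv_into Bn (\<phi> i) ` closure {x. g i x \<noteq> 0}"
  have hom: "homeomorphism Bn (\<phi> i ` Bn) (\<phi> i) (inv_into Bn (\<phi> i))"
    and cpt: "compact (closure (\<phi> i ` Bn))"
    using atlas by (auto simp: smooth_atlas_def)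
  have sub: "closure {x. g i x \<noteq> 0} \<subseteq> \<phi> i ` Bn"
    using pou by (simp add: smooth_partition_of_unity_def)
  then have "closure {x. g i x \<noteq> 0} \<subseteq> closure (\<phi> i ` Bn)" using closure_subset by (rule order_trans)
  then have "compact (closure {x. g i x \<noteq> 0})"
    using compact_Int_closed[OF cpt closed_closure, of "{x. g i x \<noteq> 0}"] by (simp add: Int_absorb1)
  then have "compact K"
    unfolding K_def using hom sub
    by (intro compact_continuous_image) (auto simp: homeomorphism_def intro: continuous_on_subset)
  have KB: "K \<subseteq> Bn" unfolding K_def using sub by (auto intro!: inv_into_into)
  have inK: "y \<in> K" if "y \<in> Bn" "g i (\<phi> i y) \<noteq> 0" for y
  proof -
    have "\<phi> i y \<in> closure {x. g i x \<noteq> 0}" using that(2) by (intro subsetD[OF closure_subset]) simp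
    moreover have "inv_into Bn (\<phi> i) (\<phi> i y) = y" using hom that(1) by (simp add: homeomorphism_def)
    ultimately show ?thesis unfolding K_def by (metis image_eqI)
  qed
  show ?thesis
  proof (cases "K = {}")
    case True
    then show ?thesis using inK that[of 0] by fastforce
  next
    case False
    then obtain z where z: "z \<in> K" "\<And>y. y \<in> K \<Longrightarrow> norm y \<le> norm z"
      using continuous_attains_sup[OF \<open>compact K\<close>, of norm] by (auto intro: continuous_intros)
    then have "norm z < 1" using KB by auto
    moreover have "g i (\<phi> i y) = 0" if "y \<in> Bn" "norm y > norm z" for y
      using inK[OF that(1)] z(2)[of y] that(2) by linarith
    ultimately show ?thesis using that[of "norm z"] by simp
  qed
qed

lemma continuous_on_chart:
  assumes "smooth_atlas \<phi>" and "continuous_on UNIV f"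
  shows "continuous_on Bn (\<lambda>y. f (\<phi> i y))"
  using assms continuous_on_compose2[OF assms(2), of Bn "\<phi> i"]
  by (auto simp: smooth_atlas_def homeomorphism_def)

lemma continuous_on_partition_chart:
  assumes "smooth_partition_of_unity \<phi> g"
  shows "continuous_on Bn (\<lambda>y. g i (\<phi> i y))"
proof -
  have "smooth_on Bn (g i \<circ> \<phi> i)"
    using assms by (simp add: smooth_partition_of_unity_def smooth_fun_def)
  then show ?thesis unfolding smooth_on_def o_def by (metis Ck_on.simps(1))
qed

lemma continuous_on_chart_cutoff:
  assumes "smooth_atlas \<phi>" "smooth_partition_of_unity \<phi> g" "continuous_on UNIV f"
  shows "continuous_on Bn (chart_cutoff \<phi> g f i)"
proof -
  have "continuous_on Bn (\<lambda>y. g i (\<phi> i y) * f (\<phi> i y))"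
    by (intro continuous_on_mult continuous_on_partition_chart[OF assms(2)] continuous_on_chart[OF assms(1,3)])
  then show ?thesis
    by (rule continuous_on_cong[THEN iffD1, rotated -1]) (auto simp: chart_cutoff_def)
qed

lemma open_chart_preimage:
  assumes "smooth_atlas \<phi>" and "open U"
  shows "open {z\<in>Bn. \<phi> j z \<in> U}"
proof -
  have "continuous_on Bn (\<phi> j)" using assms(1) by (simp add: smooth_atlas_def homeomorphism_def)
  then have "open (Bn \<inter> \<phi> j -` U)" using assms(2) by (rule continuous_open_preimage[OF _ open_ball])
  moreover have "{z\<in>Bn. \<phi> j z \<in> U} = Bn \<inter> \<phi> j -` U" by blast
  ultimately show ?thesis by (simp only:)
qed

lemma chart_cutoff_bounded:
  fixes \<phi> :: "'i \<Rightarrow> real^'n \<Rightarrow> 'm::t2_space"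
  assumes atlas: "smooth_atlas \<phi>" and pou: "smooth_partition_of_unity \<phi> g" and f: "continuous_on UNIV f"
  obtains M where "M \<ge> 0" "\<forall>y. \<bar>chart_cutoff \<phi> g f i y\<bar> \<le> M"
proof -
  obtain r where r: "0 \<le> r" "r < 1" "\<And>y. y \<in> Bn \<Longrightarrow> norm y > r \<Longrightarrow> g i (\<phi> i y) = 0"
    using chart_support_radius[OF atlas pou] by blast
  have "continuous_on (cball 0 r) (chart_cutoff \<phi> g f i)"
    by (rule continuous_on_subset[OF continuous_on_chart_cutoff[OF assms]]) (use r in auto)
  then show ?thesis
    by (rule bounded_zero_outside) (use r that in \<open>auto simp: chart_cutoff_def\<close>)
qed

lemma chart_cutoff_uniformly_continuous:
  fixes \<phi> :: "'i \<Rightarrow> real^'n \<Rightarrow> 'm::t2_space"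
  assumes atlas: "smooth_atlas \<phi>" and pou: "smooth_partition_of_unity \<phi> g" and f: "continuous_on UNIV f"
    and \<epsilon>: "\<epsilon> > 0"
  obtains \<delta> where "\<delta> > 0"
    "\<And>x y. norm (y - x) < \<delta> \<Longrightarrow> \<bar>chart_cutoff \<phi> g f i y - chart_cutoff \<phi> g f i x\<bar> \<le> \<epsilon>"
proof -
  obtain r where r: "0 \<le> r" "r < 1" "\<And>y. y \<in> Bn \<Longrightarrow> norm y > r \<Longrightarrow> g i (\<phi> i y) = 0"
    using chart_support_radius[OF atlas pou] by blast
  have "continuous_on (cball 0 ((1 + r) / 2)) (chart_cutoff \<phi> g f i)"
    by (rule continuous_on_subset[OF continuous_on_chart_cutoff[OF atlas pou f]]) (use r in auto)
  moreover have "r < (1 + r) / 2" using r by simp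
  moreover have "chart_cutoff \<phi> g f i y = 0" if "y \<notin> cball 0 r" for y
    using r that by (auto simp: chart_cutoff_def)
  ultimately show ?thesis using \<epsilon> that by (rule uniformly_continuous_zero_outside)
qed

lemma semiconcave_chart_cutoff:
  fixes \<phi> :: "'i \<Rightarrow> real^'n \<Rightarrow> 'm::t2_space"
  assumes atlas: "smooth_atlas \<phi>" and pou: "smooth_partition_of_unity \<phi> g"
    and u: "continuous_on UNIV u" "loc_semiconcave \<phi> u"
  shows "\<exists>C>0. semiconcave_with C (chart_cutoff \<phi> g u i)"
proof -
  obtain r where r: "0 \<le> r" "r < 1" "\<And>y. y \<in> Bn \<Longrightarrow> norm y > r \<Longrightarrow> g i (\<phi> i y) = 0"
    using chart_support_radius[OF atlas pou] by blast
  obtain b where b: "b > 0" "concave_on Bn (\<lambda>y. u (\<phi> i y) - (norm y)\<^sup>2 / b)"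
    using u(2) unfolding loc_semiconcave_def by blast
  have "smooth_on Bn (\<lambda>y. g i (\<phi> i y))" "\<And>y. g i (\<phi> i y) \<ge> 0"
    using pou by (auto simp: smooth_partition_of_unity_def smooth_fun_def o_def)
  then have "\<exists>C>0. semiconcave_with C (\<lambda>y. if y \<in> Bn then g i (\<phi> i y) * u (\<phi> i y) else 0)"
    by (rule semiconcave_cutoff[OF _ _ r continuous_on_chart[OF atlas u(1)] b(2,1)])
  then show ?thesis by (simp add: chart_cutoff_def[abs_def])
qed

lemma chart_cutoff_mono:
  assumes "smooth_partition_of_unity \<phi> g" and "\<And>x. f x \<le> h x"
  shows "chart_cutoff \<phi> g f i y \<le> chart_cutoff \<phi> g h i y"
  using assms by (auto simp: chart_cutoff_def smooth_partition_of_unity_def intro: mult_left_mono)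

text \<open>On the chart image the term is \<open>R_op\<close> composed with a smooth transition
  map. The hypothesis \<open>zero\<close> prevents a jump at the edge of the chart: off the closed
  support of \<open>g i\<close> the term vanishes on a neighbourhood.\<close>

lemma G_term_C11_at:
  fixes \<phi> :: "'i \<Rightarrow> real^'n \<Rightarrow> 'm::t2_space"
  assumes atlas: "smooth_atlas \<phi>" and pou: "smooth_partition_of_unity \<phi> g"
    and bdd: "\<forall>y. \<bar>chart_cutoff \<phi> g f i y\<bar> \<le> M" and s: "t * a i > 0"
    and zero: "\<And>x. g i x = 0 \<Longrightarrow> G_term \<phi> g a t f i x = 0" and y: "y \<in> Bn"
  shows "C11_at (\<lambda>z. G_term \<phi> g a t f i (\<phi> j z)) y"
proof -
  show ?thesis
  proof (cases "\<phi> j y \<in> closure {x. g i x \<noteq> 0}")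
    case True
    define V where "V = {z\<in>Bn. \<phi> j z \<in> \<phi> i ` Bn}"
    have "open (\<phi> i ` Bn)" using atlas by (simp add: smooth_atlas_def)
    then have V: "open V"
      unfolding V_def by (rule open_chart_preimage[OF atlas])
    have yV: "y \<in> V" using pou True y by (auto simp: V_def smooth_partition_of_unity_def)
    have "smooth_on V (inv_into Bn (\<phi> i) \<circ> \<phi> j)" using atlas by (simp add: smooth_atlas_def V_def)
    then have "C11_at (inv_into Bn (\<phi> i) \<circ> \<phi> j) y" using V yV by (rule smooth_on_C11_at)
    then have "C11_at (\<lambda>z. R_op (t * a i) (chart_cutoff \<phi> g f i) ((inv_into Bn (\<phi> i) \<circ> \<phi> j) z)) y"
      by (rule C11_at_compose) (rule R_op_C11_at[OF bdd s])
    then show ?thesis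
      by (rule C11_at_cong[OF _ V yV]) (simp add: G_term_eq V_def)
  next
    case False
    define V where "V = {z\<in>Bn. \<phi> j z \<in> - closure {x. g i x \<noteq> 0}}"
    have V: "open V"
      unfolding V_def by (rule open_chart_preimage[OF atlas]) (simp add: open_Compl)
    have yV: "y \<in> V" using False y by (simp add: V_def)
    have "G_term \<phi> g a t f i (\<phi> j z) = 0" if "z \<in> V" for z
      using that closure_subset[of "{x. g i x \<noteq> 0}"] by (intro zero) (auto simp: V_def)
    then show ?thesis by (rule C11_at_cong[OF C11_at_const V yV])
  qed
qed

lemma G_term_converges:
  fixes \<phi> :: "'i \<Rightarrow> real^'n \<Rightarrow> 'm::t2_space"
  assumes atlas: "smooth_atlas \<phi>" and pou: "smooth_partition_of_unity \<phi> g" and f: "continuous_on UNIV f"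
    and a: "a i > 0" and \<epsilon>: "\<epsilon> > 0"
  shows "\<forall>\<^sub>F t in at_right 0. \<forall>x. \<bar>G_term \<phi> g a t f i x - g i x * f x\<bar> \<le> \<epsilon>"
proof -
  obtain M where M: "M \<ge> 0" "\<forall>y. \<bar>chart_cutoff \<phi> g f i y\<bar> \<le> M"
    using chart_cutoff_bounded[OF atlas pou f] by blast
  obtain \<delta> where \<delta>: "\<delta> > 0"
    "\<And>x y. norm (y - x) < \<delta> \<Longrightarrow> \<bar>chart_cutoff \<phi> g f i y - chart_cutoff \<phi> g f i x\<bar> \<le> \<epsilon> / 2"
    using chart_cutoff_uniformly_continuous[OF atlas pou f, of "\<epsilon> / 2"] \<epsilon> by auto
  \<comment> \<open>Below this threshold \<open>R_op_approx\<close> applies with s = t a_i; the 1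
    excludes a zero denominator when M = 0.\<close>
  have "0 < \<delta>\<^sup>2 / (4 * M * a i + 1)" using \<delta> M a by (intro divide_pos_pos) (auto simp: add_nonneg_pos)
  then have "\<forall>\<^sub>F t in at_right 0. t \<in> {0<..<\<delta>\<^sup>2 / (4 * M * a i + 1)}" by (rule eventually_at_right_real)
  then show ?thesis
  proof eventually_elim
    case (elim t)
    have "t * (4 * M * a i) \<le> t * (4 * M * a i + 1)" using elim by simp
    also have "\<dots> \<le> \<delta>\<^sup>2" using elim M a by (simp add: pos_less_divide_eq add_nonneg_pos less_imp_le)
    finally have "4 * M * (t * a i) \<le> \<delta>\<^sup>2" by (simp add: ac_simps)
    then have "\<bar>R_op (t * a i) (chart_cutoff \<phi> g f i) z - chart_cutoff \<phi> g f i z\<bar> \<le> 2 * (\<epsilon> / 2)" for z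
      using elim a \<delta> \<epsilon> by (intro R_op_approx[OF M(2), where \<delta> = \<delta>]) auto
    then have *: "\<bar>R_op (t * a i) (chart_cutoff \<phi> g f i) z - chart_cutoff \<phi> g f i z\<bar> \<le> \<epsilon>" for z
      by simp
    show ?case
    proof
      fix x
      show "\<bar>G_term \<phi> g a t f i x - g i x * f x\<bar> \<le> \<epsilon>"
      proof (cases "x \<in> \<phi> i ` Bn")
        case True
        then show ?thesis using *[of "inv_into Bn (\<phi> i) x"] chart_cutoff_inv_into[of x \<phi> i g f] True
          by (simp add: G_term_eq)
      next
        case False
        then show ?thesis using partition_support[OF pou False] \<epsilon> by (simp add: G_term_eq)
      qed
    qed
  qed
qed

section \<open>Choice of the constants and assembly of the local terms\<close>

theorem theorem4:
  fixes \<phi> :: "'i \<Rightarrow> real^'n \<Rightarrow> 'm::t2_space"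
    and g :: "'i \<Rightarrow> 'm \<Rightarrow> real"
    and u v :: "'m \<Rightarrow> real"
  assumes "paracompact_space TYPE('m)"
    and "smooth_atlas \<phi>"
    and "smooth_partition_of_unity \<phi> g"
    and "continuous_on UNIV u" and "continuous_on UNIV v"
    and "\<forall>x. v x \<le> u x"
    and "loc_semiconcave \<phi> u" and "loc_semiconcave \<phi> (\<lambda>x. - v x)"
  shows "\<exists>a. (\<forall>i. a i > 0) \<and>
    (\<forall>f. (\<forall>x. v x \<le> f x \<and> f x \<le> u x) \<longrightarrow>
       (\<forall>t\<in>{0<..1}.
          (\<forall>x. \<exists>N. open N \<and> x \<in> N \<and> finite {i. \<exists>y\<in>N. G_term \<phi> g a t f i y \<noteq> 0}) \<and>
          loc_C11 \<phi> (G_op \<phi> g a t f) \<and>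
          (\<forall>x. v x \<le> G_op \<phi> g a t f x \<and> G_op \<phi> g a t f x \<le> u x)) \<and>
       (continuous_on UNIV f \<longrightarrow>
          (\<forall>x. \<exists>N. open N \<and> x \<in> N \<and> uniform_limit N (\<lambda>t. G_op \<phi> g a t f) f (at_right 0))))"
proof -
  note atlas = assms(2) and pou = assms(3) and u = assms(4,7) and v = assms(5,8)
  have "\<forall>i. \<exists>C>0. semiconcave_with C (chart_cutoff \<phi> g u i)"
    using semiconcave_chart_cutoff[OF atlas pou u] by blast
  then obtain A where A: "\<And>i. A i > 0" "\<And>i. semiconcave_with (A i) (chart_cutoff \<phi> g u i)" by metis
  have "\<forall>i. \<exists>C>0. semiconcave_with C (\<lambda>y. - chart_cutoff \<phi> g v i y)"
    using semiconcave_chart_cutoff[OF atlas pou continuous_on_minus[OF v(1)] v(2)]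
    by (simp add: chart_cutoff_uminus)
  then obtain B where B: "\<And>i. B i > 0" "\<And>i. semiconcave_with (B i) (\<lambda>y. - chart_cutoff \<phi> g v i y)" by metis
  \<comment> \<open>With t <= 1 this gives 1/(t a_i) >= 1/a_i, which is at least both semi-concavity
    constants.\<close>
  define a where "a i = 1 / max (A i) (B i)" for i
  have a: "a i > 0" for i using A(1)[of i] by (simp add: a_def less_max_iff_disj)
  have supp: "closure {x. g i x \<noteq> 0} \<subseteq> \<phi> i ` Bn" and g0: "g i x \<ge> 0"
    and locfin: "\<exists>N. open N \<and> x \<in> N \<and> finite {i. closure {y. g i y \<noteq> 0} \<inter> N \<noteq> {}}"
    and sum1: "(\<Sum>i\<in>{i. g i x \<noteq> 0}. g i x) = 1" for i x
    using pou by (auto simp: smooth_partition_of_unity_def)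
  have near: "{i. g i x \<noteq> 0} \<subseteq> {i. closure {y. g i y \<noteq> 0} \<inter> N \<noteq> {}}" if "x \<in> N" for x N
    using that closure_subset[of "{x. g _ x \<noteq> 0}"] by auto
  have fin: "finite {i. g i x \<noteq> 0}" for x
    using locfin[of x] near finite_subset by metis
  have sum_g: "(\<Sum>i\<in>{i. g i x \<noteq> 0}. g i x * c) = c" for x c
    using sum1[of x] by (simp flip: sum_distrib_right)
  show ?thesis
  proof (intro exI[of _ a] conjI allI impI ballI)
    show "a i > 0" for i by (rule a)
    fix f assume f: "\<forall>x. v x \<le> f x \<and> f x \<le> u x"
    \<comment> \<open>An arbitrary f between u and v may be discontinuous; its cutoffs are bounded
      only because they lie between those of u and v.\<close>
    have bdd: "\<exists>M. \<forall>y. \<bar>chart_cutoff \<phi> g h i y\<bar> \<le> M" if "\<And>x. v x \<le> h x \<and> h x \<le> u x" for h i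
    proof -
      obtain M M' where M: "\<forall>y. \<bar>chart_cutoff \<phi> g u i y\<bar> \<le> M" "\<forall>y. \<bar>chart_cutoff \<phi> g v i y\<bar> \<le> M'"
        using chart_cutoff_bounded[OF atlas pou u(1)] chart_cutoff_bounded[OF atlas pou v(1)] by metis
      have "\<bar>chart_cutoff \<phi> g h i y\<bar> \<le> max M M'" for y
        using chart_cutoff_mono[OF pou, of v h i y] chart_cutoff_mono[OF pou, of h u i y] that
          M[rule_format, of y] by (smt (verit))
      then show ?thesis by blast
    qed
    have bounds: "g i x * v x \<le> G_term \<phi> g a t f i x \<and> G_term \<phi> g a t f i x \<le> g i x * u x"
      if t: "t \<in> {0<..1}" for t i x
    proof (cases "x \<in> \<phi> i ` Bn")
      case False
      then show ?thesis using partition_support[OF pou False] by (simp add: G_term_eq)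
    next
      case True
      let ?z = "inv_into Bn (\<phi> i) x"
      obtain Mu Mv Mf where M: "\<forall>y. \<bar>chart_cutoff \<phi> g u i y\<bar> \<le> Mu" "\<forall>y. \<bar>chart_cutoff \<phi> g v i y\<bar> \<le> Mv"
        "\<forall>y. \<bar>chart_cutoff \<phi> g f i y\<bar> \<le> Mf"
        using bdd[of u i] bdd[of v i] bdd[of f i] f assms(6) by blast
      define M where "M = max Mu (max Mv Mf)"
      have b: "\<forall>y. \<bar>chart_cutoff \<phi> g u i y\<bar> \<le> M" "\<forall>y. \<bar>chart_cutoff \<phi> g v i y\<bar> \<le> M"
        "\<forall>y. \<bar>chart_cutoff \<phi> g f i y\<bar> \<le> M"
        using M by (auto simp: M_def le_max_iff_disj)
      have s: "t * a i > 0" using t a[of i] by simp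
      have "max (A i) (B i) = 1 / a i" by (simp add: a_def)
      also have "\<dots> \<le> 1 / (t * a i)"
        using t a[of i] s by (intro divide_left_mono) auto
      finally have "A i \<le> 1 / (t * a i)" "B i \<le> 1 / (t * a i)" by simp_all
      then have "chart_cutoff \<phi> g v i ?z \<le> R_op (t * a i) (chart_cutoff \<phi> g f i) ?z"
        "R_op (t * a i) (chart_cutoff \<phi> g f i) ?z \<le> chart_cutoff \<phi> g u i ?z"
        using R_op_ge[OF b(3,2) s B(2)] R_op_le[OF b(3,1) s A(2)] chart_cutoff_mono[OF pou] f by blast+
      then show ?thesis using True by (simp add: G_term_eq chart_cutoff_inv_into)
    qed
    have zero: "G_term \<phi> g a t f i x = 0" if "t \<in> {0<..1}" "g i x = 0" for t i x
      using bounds[OF that(1), of i x] that(2) by simp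
    \<comment> \<open>The index set may be enlarged to any finite superset, in particular to one
      that is fixed on a whole neighbourhood.\<close>
    have G_eq: "G_op \<phi> g a t f x = (\<Sum>i\<in>F. G_term \<phi> g a t f i x)"
      if "t \<in> {0<..1}" "finite F" "{i. g i x \<noteq> 0} \<subseteq> F" for t x F
      unfolding G_op_def using that zero by (intro sum.mono_neutral_left) blast+
    {
      fix t :: real assume t: "t \<in> {0<..1}"
      fix x
      obtain N where N: "open N" "x \<in> N" "finite {i. closure {y. g i y \<noteq> 0} \<inter> N \<noteq> {}}"
        using locfin by blast
      have "{i. \<exists>y\<in>N. G_term \<phi> g a t f i y \<noteq> 0} \<subseteq> {i. closure {y. g i y \<noteq> 0} \<inter> N \<noteq> {}}"
        using near zero[OF t] by blast
      then show "\<exists>N. open N \<and> x \<in> N \<and> finite {i. \<exists>y\<in>N. G_term \<phi> g a t f i y \<noteq> 0}"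
        using N finite_subset by blast
    next
      fix t :: real assume t: "t \<in> {0<..1}"
      fix x
      have G: "G_op \<phi> g a t f x = (\<Sum>i\<in>{i. g i x \<noteq> 0}. G_term \<phi> g a t f i x)"
        by (rule G_eq[OF t fin order_refl])
      show "v x \<le> G_op \<phi> g a t f x" "G_op \<phi> g a t f x \<le> u x"
        using sum_mono[of "{i. g i x \<noteq> 0}" "\<lambda>i. g i x * v x" "\<lambda>i. G_term \<phi> g a t f i x"]
          sum_mono[of "{i. g i x \<noteq> 0}" "\<lambda>i. G_term \<phi> g a t f i x" "\<lambda>i. g i x * u x"]
        unfolding G sum_g using bounds[OF t] by auto
    next
      fix t :: real assume t: "t \<in> {0<..1}"
      show "loc_C11 \<phi> (G_op \<phi> g a t f)"
        unfolding loc_C11_def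
      proof (intro allI ballI)
        fix j and y :: "real^'n" assume y: "y \<in> Bn"
        obtain N where N: "open N" "\<phi> j y \<in> N" "finite {i. closure {y. g i y \<noteq> 0} \<inter> N \<noteq> {}}"
          using locfin by blast
        let ?F = "{i. closure {y. g i y \<noteq> 0} \<inter> N \<noteq> {}}"
        define V where "V = {z\<in>Bn. \<phi> j z \<in> N}"
        have V: "open V" unfolding V_def by (rule open_chart_preimage[OF atlas N(1)])
        have yV: "y \<in> V" using N y by (simp add: V_def)
        have "C11_at (\<lambda>z. \<Sum>i\<in>?F. G_term \<phi> g a t f i (\<phi> j z)) y"
        proof (rule C11_at_sum[OF N(3)])
          fix i
          obtain M where M: "\<forall>y. \<bar>chart_cutoff \<phi> g f i y\<bar> \<le> M" using bdd f by blast
          show "C11_at (\<lambda>z. G_term \<phi> g a t f i (\<phi> j z)) y"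
            using zero[OF t] t a[of i] y by (intro G_term_C11_at[OF atlas pou M]) auto
        qed
        then have "C11_at (G_op \<phi> g a t f \<circ> \<phi> j) y"
          by (rule C11_at_cong[OF _ V yV]) (use G_eq[OF t N(3) near] in \<open>simp add: V_def\<close>)
        then obtain e grad L where e: "e > 0" 
          "\<And>z. z \<in> ball y e \<Longrightarrow> GDERIV (G_op \<phi> g a t f \<circ> \<phi> j) z :> grad z" "L-lipschitz_on (ball y e) grad"
          using C11_at_gradient by metis
        then show "\<exists>V. open V \<and> y \<in> V \<and> V \<subseteq> Bn \<and>
          (\<exists>grad L. (\<forall>z\<in>V. GDERIV (G_op \<phi> g a t f \<circ> \<phi> j) z :> grad z) \<and> L-lipschitz_on V grad)"
          using y by (intro exI[of _ "ball y e \<inter> Bn"] conjI exI[of _ grad] exI[of _ L])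
            (auto intro: lipschitz_on_subset)
      qed
    next
      assume cf: "continuous_on UNIV f"
      fix x
      obtain N where N: "open N" "x \<in> N" "finite {i. closure {y. g i y \<noteq> 0} \<inter> N \<noteq> {}}"
        using locfin by blast
      let ?F = "{i. closure {y. g i y \<noteq> 0} \<inter> N \<noteq> {}}"
      have "uniform_limit N (\<lambda>t. G_op \<phi> g a t f) f (at_right 0)"
        unfolding uniform_limit_iff
      proof (intro allI impI)
        fix \<epsilon> :: real assume \<epsilon>: "\<epsilon> > 0"
        \<comment> \<open>The extra 1 makes the final estimate strict.\<close>
        define \<epsilon>' where "\<epsilon>' = \<epsilon> / (card ?F + 1)"
        have "\<epsilon>' > 0" using \<epsilon> by (simp add: \<epsilon>'_def)
        then have "\<forall>\<^sub>F t in at_right 0. \<forall>i\<in>?F. \<forall>x. \<bar>G_term \<phi> g a t f i x - g i x * f x\<bar> \<le> \<epsilon>'"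
          using G_term_converges[OF atlas pou cf, of a] a by (intro eventually_ball_finite[OF N(3)]) blast
        \<comment> \<open>The representation \<open>G_eq\<close> is available only for t in (0,
          1].\<close>
        moreover have "\<forall>\<^sub>F t in at_right 0. t \<in> {0<..<1::real}" by (rule eventually_at_right_real) simp
        ultimately show "\<forall>\<^sub>F t in at_right 0. \<forall>x\<in>N. dist (G_op \<phi> g a t f x) (f x) < \<epsilon>"
        proof eventually_elim
          case (elim t)
          show ?case
          proof
            fix x assume x: "x \<in> N"
            have "f x = (\<Sum>i\<in>?F. g i x * f x)"
              using sum.mono_neutral_left[OF N(3) near[OF x], of "\<lambda>i. g i x * f x"] sum_g[of x "f x"] by simp
            moreover have "G_op \<phi> g a t f x = (\<Sum>i\<in>?F. G_term \<phi> g a t f i x)"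
              using elim N(3) near[OF x] by (intro G_eq) auto
            ultimately have "\<bar>G_op \<phi> g a t f x - f x\<bar> = \<bar>\<Sum>i\<in>?F. G_term \<phi> g a t f i x - g i x * f x\<bar>"
              by (simp add: sum_subtractf)
            also have "\<dots> \<le> (\<Sum>i\<in>?F. \<epsilon>')"
              using elim by (intro order_trans[OF sum_abs] sum_mono) auto
            also have "\<dots> < (card ?F + 1) * \<epsilon>'" using \<open>\<epsilon>' > 0\<close> by simp
            also have "\<dots> = \<epsilon>" unfolding \<epsilon>'_def by simp
            finally show "dist (G_op \<phi> g a t f x) (f x) < \<epsilon>" by (simp add: dist_real_def)
          qed
        qed
      qed
      then show "\<exists>N. open N \<and> x \<in> N \<and> uniform_limit N (\<lambda>t. G_op \<phi> g a t f) f (at_right 0)"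
        using N by blast
    }
  qed
qed

end
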